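(* Let $\Omega'$ be $\mathbb{R}^{N_1}$ (or, more generally, an orientable differentiable manifold of dimension $N_1$, the formulas below then being written in local coordinates) with measure $dm_1(\mathbf{x})=\gamma_1(\mathbf{x})\prod_{k=1}^{N_1}dx_k$, and let $\Omega''=\mathbb{R}^{N_2}$ with Lebesgue measure $dm_2(\mathbf{y})=\prod_{j=1}^{N_2}dy_j$. Consider on $\Omega'\times\Omega''$ the system $$\frac{dx_k}{dt}=U_k(t,\mathbf{x}),\quad 1\le k\le N_1,\qquad \frac{dy_j}{dt}=V_j(t,\mathbf{y},\mathbf{x}),\quad 1\le j\le N_2,$$ where $$\sum_{j=1}^{N_2}\frac{\partial V_j(t,\mathbf{y},\mathbf{x})}{\partial y_j}=0 .$$ Let $\rho(t,\mathbf{x},\mathbf{y})$ be the joint probability density (with respect to $m_1\otimes m_2$) at time $t$ of the solution of this system with random initial conditions, so that $$\frac{\partial\rho}{\partial t}+\frac{1}{\gamma_1(\mathbf{x})}\sum_{k=1}^{N_1}\frac{\partial}{\partial x_k}\left[\rho\gamma_1U_k\right]+\sum_{j=1}^{N_2}\frac{\partial}{\partial y_j}\left[\rho V_j\right]=0,$$ and let $\rho_1(t,\mathbf{x})=\int_{\Omega''}\rho(t,\mathbf{x},\mathbf{y})\,dm_2(\mathbf{y})$ be the probability density of $\mathbf{x}(t)$ with respect to $m_1$, which satisfies $$\frac{\partial\rho_1}{\partial t}+\frac{1}{\gamma_1(\mathbf{x})}\sum_{k=1}^{N_1}\frac{\partial}{\partial x_k}\left[\rho_1\gamma_1U_k\right]=0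 .$$ Assume that the initial conditions $\mathbf{x}(0)$ and $\mathbf{y}(0)$ are independent, i.e. $$\rho(0,\mathbf{x},\mathbf{y})=\rho_1(0,\mathbf{x})\,\rho_2(\mathbf{y}),\qquad \rho_2(\mathbf{y})=\int_{\Omega'}\rho(0,\mathbf{x},\mathbf{y})\,dm_1(\mathbf{x}).$$ Then, for all $t$ and all parameters $p,q$ for which the quantities involved are defined, $$I_{p,q}(t,\rho)=\int_{\Omega''}\left|\rho_2(\mathbf{y})\right|^{q}\,dm_2(\mathbf{y}).$$ Consequently the value of $I_{p,q}(t,\rho)$ depends only on the initial density $\rho_2$ (and on $q$); it does not depend on the time $t$, on the parameter $p$, or on the function $\gamma_1$ defining the measure $m_1$.
   Context: For real parameters $p,q$ define $$N^{(1)}_{q}(t;\rho_1)=\int_{\Omega'}\left[\rho_1(t,\mathbf{x})\right]^{q}dm_1(\mathbf{x}),\qquad N^{(2)}_{p,q}(t;\rho)=\int_{\Omega'}dm_1(\mathbf{x})\left[\int_{\Omega''}dm_2(\mathbf{y})\left|\rho(t,\mathbf{x},\mathbf{y})\right|^{q}\right]^{p},$$ $$I_{p,q}(t,\rho)=\left[\frac{N^{(2)}_{p,q}(t;\rho)}{N^{(1)}_{pq}(t;\rho_1)}\right]^{1/p}.$$ In the denominator, $N^{(1)}_{pq}$ is $N^{(1)}$ with parameter equal to the product $pq$. "Defined" means that $p,q>0$ and that the integrals $N^{(1)}_{pq}(t;\rho_1)$ and $N^{(2)}_{p,q}(t;\rho)$ are finite and nonzero. Standing conventions: $\gamma_1>0$;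 the vector fields $U,V$ are smooth enough that the system has unique solutions and its evolution (flow) maps between any two times under consideration are globally defined diffeomorphisms. The density $\rho(t,\cdot,\cdot)$ is the density of the image of the initial probability law under the evolution map from time $0$ to time $t$. Changing $\gamma_1$ changes the reference measure $m_1$, and the densities $\rho,\rho_1$ are taken with respect to the measure in use. *)

theory Defs
  imports "HOL-Probability.Probability"
begin

text \<open>
  The base space \<open>\<Omega>'\<close> is a type \<open>'m\<close> with an oriented atlas. Only continuous differentiability
  (\<open>C\<^sup>1\<close>) is demanded of transition maps and diffeomorphisms, so smooth manifolds are covered; the
  case \<open>\<Omega>' = \<real>\<^sup>N\<close> is the atlas whose only chart is the identity (see the lemmas on
  \<open>euclidean_atlas\<close>).
\<close>

type_synonym ('m, 'e) chart = "'m set \<times> ('m \<Rightarrow> 'e)"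

abbreviation chart_dom :: "('m, 'e) chart \<Rightarrow> 'm set" where "chart_dom \<equiv> fst"
abbreviation coords :: "('m, 'e) chart \<Rightarrow> 'm \<Rightarrow> 'e" where "coords \<equiv> snd"

definition chart_inv :: "('m, 'e) chart \<Rightarrow> 'e \<Rightarrow> 'm" where
  "chart_inv c = inv_into (chart_dom c) (coords c)"

definition is_chart :: "('m::topological_space, 'e::euclidean_space) chart \<Rightarrow> bool" where
  "is_chart c \<longleftrightarrow> open (chart_dom c) \<and> open (coords c ` chart_dom c) \<and>
     homeomorphism (chart_dom c) (coords c ` chart_dom c) (coords c) (chart_inv c)"

text \<open>Only used for open \<open>S\<close>.\<close>

definition C1_on :: "'a::real_normed_vector set \<Rightarrow> ('a \<Rightarrow> 'b::real_normed_vector) \<Rightarrow> bool" where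
  "C1_on S f \<longleftrightarrow> (\<exists>f' :: 'a \<Rightarrow> 'a \<Rightarrow>\<^sub>L 'b.
     (\<forall>x\<in>S. (f has_derivative blinfun_apply (f' x)) (at x)) \<and> continuous_on S f')"

definition transition :: "('m, 'e) chart \<Rightarrow> ('m, 'e) chart \<Rightarrow> 'e \<Rightarrow> 'e" where
  "transition c d = coords d \<circ> chart_inv c"

definition C1_atlas :: "('m::topological_space, 'e::euclidean_space) chart set \<Rightarrow> bool" where
  "C1_atlas A \<longleftrightarrow> (\<forall>c\<in>A. is_chart c) \<and> (\<Union>c\<in>A. chart_dom c) = UNIV \<and>
     (\<forall>c\<in>A. \<forall>d\<in>A. C1_on (coords c ` (chart_dom c \<inter> chart_dom d)) (transition c d))"

definition oriented_atlas :: "('m::topological_space, real ^ 'n) chart set \<Rightarrow> bool" where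
  "oriented_atlas A \<longleftrightarrow> C1_atlas A \<and>
     (\<forall>c\<in>A. \<forall>d\<in>A. \<forall>\<xi> \<in> coords c ` (chart_dom c \<inter> chart_dom d).
        0 < det (matrix (frechet_derivative (transition c d) (at \<xi>))))"

definition euclidean_atlas :: "('e::euclidean_space, 'e) chart set" where
  "euclidean_atlas = {(UNIV, id)}"

definition prod_atlas ::
  "('m, 'e) chart set \<Rightarrow> ('n, 'f) chart set \<Rightarrow> ('m \<times> 'n, 'e \<times> 'f) chart set" where
  "prod_atlas A B =
     {(chart_dom c \<times> chart_dom d, map_prod (coords c) (coords d)) | c d. c \<in> A \<and> d \<in> B}"

definition C1_map :: "('m::topological_space, 'e::euclidean_space) chart set \<Rightarrow>
    ('n::topological_space, 'f::euclidean_space) chart set \<Rightarrow> ('m \<Rightarrow> 'n) \<Rightarrow> bool" where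
  "C1_map A B f \<longleftrightarrow> continuous_on UNIV f \<and>
     (\<forall>c\<in>A. \<forall>d\<in>B. C1_on (coords c ` (chart_dom c \<inter> f -` chart_dom d))
                        (coords d \<circ> f \<circ> chart_inv c))"

definition C1_diffeo :: "('m::topological_space, 'e::euclidean_space) chart set \<Rightarrow>
    ('n::topological_space, 'f::euclidean_space) chart set \<Rightarrow> ('m \<Rightarrow> 'n) \<Rightarrow> bool" where
  "C1_diffeo A B f \<longleftrightarrow> bij f \<and> C1_map A B f \<and> C1_map B A (inv f)"

text \<open>
  \<open>dm\<^sub>1 = \<gamma>\<^sub>1 dx\<^sub>1 \<dots> dx\<^sub>N\<close>: the coefficient \<open>\<gamma> c\<close> is given in the local coordinates of the chart \<open>c\<close>.
  Its transformation law under a change of chart is implied, as all charts describe one measure.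
\<close>

definition coordinate_measure :: "('m::topological_space, 'e::euclidean_space) chart set \<Rightarrow>
    (('m, 'e) chart \<Rightarrow> 'e \<Rightarrow> real) \<Rightarrow> 'm measure \<Rightarrow> bool" where
  "coordinate_measure A \<gamma> m1 \<longleftrightarrow> sets m1 = sets borel \<and>
     (\<forall>c\<in>A. set_borel_measurable borel (coords c ` chart_dom c) (\<gamma> c) \<and>
        (\<forall>\<xi> \<in> coords c ` chart_dom c. 0 < \<gamma> c \<xi>) \<and>
        (\<forall>S \<in> sets borel. S \<subseteq> chart_dom c \<longrightarrow>
           emeasure m1 S = (\<integral>\<^sup>+\<xi>\<in>coords c ` S. ennreal (\<gamma> c \<xi>) \<partial>lborel)))"

text \<open>
  Time-dependent vector fields on the base, for times in \<open>T\<close>: \<open>U c t \<xi>\<close> is the vector of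
  components at the point with coordinates \<open>\<xi>\<close> in the chart \<open>c\<close>.
\<close>

definition vector_field :: "('m::topological_space, 'e::euclidean_space) chart set \<Rightarrow> real set \<Rightarrow>
    (('m, 'e) chart \<Rightarrow> real \<Rightarrow> 'e \<Rightarrow> 'e) \<Rightarrow> bool" where
  "vector_field A T U \<longleftrightarrow>
     (\<forall>c\<in>A. continuous_on (T \<times> coords c ` chart_dom c) (\<lambda>(t, \<xi>). U c t \<xi>)) \<and>
     (\<forall>c\<in>A. \<forall>d\<in>A. \<forall>t\<in>T. \<forall>x \<in> chart_dom c \<inter> chart_dom d.
        U d t (coords d x) =
          frechet_derivative (transition c d) (at (coords c x)) (U c t (coords c x)))"

text \<open>The fibre field \<open>V t y x\<close> is continuous and continuously differentiable in \<open>y\<close>.\<close>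

definition fibre_field :: "real set \<Rightarrow>
    (real \<Rightarrow> (real ^ 'k) \<Rightarrow> 'm::topological_space \<Rightarrow> (real ^ 'k)) \<Rightarrow> bool" where
  "fibre_field T V \<longleftrightarrow>
     continuous_on (T \<times> UNIV \<times> UNIV) (\<lambda>(t, y, x). V t y x) \<and>
     (\<exists>V' :: real \<Rightarrow> (real ^ 'k) \<Rightarrow> 'm \<Rightarrow> ((real ^ 'k) \<Rightarrow>\<^sub>L (real ^ 'k)).
        (\<forall>t\<in>T. \<forall>y x. ((\<lambda>y. V t y x) has_derivative blinfun_apply (V' t y x)) (at y)) \<and>
        continuous_on (T \<times> UNIV \<times> UNIV) (\<lambda>(t, y, x). V' t y x))"

definition divergence :: "((real ^ 'k) \<Rightarrow> (real ^ 'k)) \<Rightarrow> (real ^ 'k) \<Rightarrow> real" where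
  "divergence F y = (\<Sum>j\<in>UNIV. deriv (\<lambda>s. F (y + s *\<^sub>R axis j 1) $ j) 0)"

definition base_solution :: "('m::topological_space, 'e::euclidean_space) chart set \<Rightarrow>
    (('m, 'e) chart \<Rightarrow> real \<Rightarrow> 'e \<Rightarrow> 'e) \<Rightarrow> real set \<Rightarrow> (real \<Rightarrow> 'm) \<Rightarrow> bool" where
  "base_solution A U J x \<longleftrightarrow> continuous_on J x \<and>
     (\<forall>t\<in>J. \<forall>c\<in>A. x t \<in> chart_dom c \<longrightarrow>
        ((\<lambda>s. coords c (x s)) has_vector_derivative U c t (coords c (x t))) (at t within J))"

definition system_solution :: "('m::topological_space, 'e::euclidean_space) chart set \<Rightarrow>
    (('m, 'e) chart \<Rightarrow> real \<Rightarrow> 'e \<Rightarrow> 'e) \<Rightarrow> (real \<Rightarrow> (real ^ 'k) \<Rightarrow> 'm \<Rightarrow> (real ^ 'k)) \<Rightarrow>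
    real set \<Rightarrow> (real \<Rightarrow> 'm \<times> (real ^ 'k)) \<Rightarrow> bool" where
  "system_solution A U V J z \<longleftrightarrow> base_solution A U J (\<lambda>t. fst (z t)) \<and>
     (\<forall>t\<in>J. ((\<lambda>s. snd (z s)) has_vector_derivative V t (snd (z t)) (fst (z t))) (at t within J))"

text \<open>
  The equations for \<open>x\<close> form a closed system by themselves; uniqueness is stated for it as well as
  for the whole system, on every subinterval of the time interval.
\<close>

definition unique_solutions :: "('m::topological_space, 'e::euclidean_space) chart set \<Rightarrow>
    (('m, 'e) chart \<Rightarrow> real \<Rightarrow> 'e \<Rightarrow> 'e) \<Rightarrow> (real \<Rightarrow> (real ^ 'k) \<Rightarrow> 'm \<Rightarrow> (real ^ 'k)) \<Rightarrow>
    real set \<Rightarrow> bool" where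
  "unique_solutions A U V T \<longleftrightarrow> (\<forall>J s. is_interval J \<and> J \<subseteq> T \<and> s \<in> J \<longrightarrow>
     (\<forall>x x'. base_solution A U J x \<and> base_solution A U J x' \<and> x s = x' s \<longrightarrow>
        (\<forall>t\<in>J. x t = x' t)) \<and>
     (\<forall>z z'. system_solution A U V J z \<and> system_solution A U V J z' \<and> z s = z' s \<longrightarrow>
        (\<forall>t\<in>J. z t = z' t)))"

text \<open>\<open>\<Phi> s t\<close> is the evolution map from time \<open>s\<close> to time \<open>t\<close>.\<close>

definition evolution :: "('m::topological_space, 'e::euclidean_space) chart set \<Rightarrow>
    (('m, 'e) chart \<Rightarrow> real \<Rightarrow> 'e \<Rightarrow> 'e) \<Rightarrow> (real \<Rightarrow> (real ^ 'k) \<Rightarrow> 'm \<Rightarrow> (real ^ 'k)) \<Rightarrow>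
    real set \<Rightarrow> (real \<Rightarrow> real \<Rightarrow> 'm \<times> (real ^ 'k) \<Rightarrow> 'm \<times> (real ^ 'k)) \<Rightarrow> bool" where
  "evolution A U V T \<Phi> \<longleftrightarrow>
     (\<forall>s\<in>T. \<forall>z. system_solution A U V T (\<lambda>t. \<Phi> s t z) \<and> \<Phi> s s z = z) \<and>
     (\<forall>s\<in>T. \<forall>t\<in>T.
        C1_diffeo (prod_atlas A euclidean_atlas) (prod_atlas A euclidean_atlas) (\<Phi> s t))"

text \<open>
  \<open>\<rho> t\<close> is a density, with respect to \<open>m\<^sub>1 \<otimes> m\<^sub>2\<close>, of the law at time \<open>t\<close> of the solution with random
  initial conditions \<open>(X, Y)\<close>. The continuity equations for \<open>\<rho>\<close> and its marginal are consequences
  of this when the densities are differentiable; neither they nor any regularity of \<open>\<rho>\<close> are demanded.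
\<close>

definition solution_density :: "'w measure \<Rightarrow> ('w \<Rightarrow> 'm::topological_space) \<Rightarrow>
    ('w \<Rightarrow> (real ^ 'k)) \<Rightarrow> real set \<Rightarrow> (real \<Rightarrow> real \<Rightarrow> 'm \<times> (real ^ 'k) \<Rightarrow> 'm \<times> (real ^ 'k)) \<Rightarrow>
    'm measure \<Rightarrow> (real \<Rightarrow> 'm \<Rightarrow> (real ^ 'k) \<Rightarrow> real) \<Rightarrow> bool" where
  "solution_density P X Y T \<Phi> m1 \<rho> \<longleftrightarrow> (\<forall>t\<in>T. (\<forall>x y. 0 \<le> \<rho> t x y) \<and>
     distributed P (m1 \<Otimes>\<^sub>M lborel) (\<lambda>\<omega>. \<Phi> 0 t (X \<omega>, Y \<omega>)) (\<lambda>(x, y). ennreal (\<rho> t x y)))"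

definition rho1 :: "(real \<Rightarrow> 'm \<Rightarrow> (real ^ 'k) \<Rightarrow> real) \<Rightarrow> real \<Rightarrow> 'm \<Rightarrow> real" where
  "rho1 \<rho> t x = (LINT y|lborel. \<rho> t x y)"

definition rho2 :: "'m measure \<Rightarrow> (real \<Rightarrow> 'm \<Rightarrow> (real ^ 'k) \<Rightarrow> real) \<Rightarrow> (real ^ 'k) \<Rightarrow> real" where
  "rho2 m1 \<rho> y = (LINT x|m1. \<rho> 0 x y)"

definition N1 :: "'m measure \<Rightarrow> real \<Rightarrow> real \<Rightarrow> (real \<Rightarrow> 'm \<Rightarrow> real) \<Rightarrow> real" where
  "N1 m1 q t r1 = (LINT x|m1. r1 t x powr q)"

definition N2 :: "'m measure \<Rightarrow> real \<Rightarrow> real \<Rightarrow> real \<Rightarrow>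
    (real \<Rightarrow> 'm \<Rightarrow> (real ^ 'k) \<Rightarrow> real) \<Rightarrow> real" where
  "N2 m1 p q t \<rho> = (LINT x|m1. (LINT y|lborel. \<bar>\<rho> t x y\<bar> powr q) powr p)"

definition I_pq :: "'m measure \<Rightarrow> real \<Rightarrow> real \<Rightarrow> real \<Rightarrow>
    (real \<Rightarrow> 'm \<Rightarrow> (real ^ 'k) \<Rightarrow> real) \<Rightarrow> real" where
  "I_pq m1 p q t \<rho> = (N2 m1 p q t \<rho> / N1 m1 (p * q) t (rho1 \<rho>)) powr (1 / p)"

text \<open>
  The integrals \<open>N1\<close> and \<open>N2\<close> are finite and nonzero. As \<open>p > 0\<close>, finiteness of \<open>N2\<close> includes that
  the inner integral is finite for almost every \<open>x\<close>; this must be said explicitly because the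
  Bochner integral of a non-integrable function is \<open>0\<close>.
\<close>

definition I_defined :: "'m measure \<Rightarrow> real \<Rightarrow> real \<Rightarrow> real \<Rightarrow>
    (real \<Rightarrow> 'm \<Rightarrow> (real ^ 'k) \<Rightarrow> real) \<Rightarrow> bool" where
  "I_defined m1 p q t \<rho> \<longleftrightarrow> p > 0 \<and> q > 0 \<and>
     integrable m1 (\<lambda>x. rho1 \<rho> t x powr (p * q)) \<and> N1 m1 (p * q) t (rho1 \<rho>) \<noteq> 0 \<and>
     (AE x in m1. integrable lborel (\<lambda>y. \<bar>\<rho> t x y\<bar> powr q)) \<and>
     integrable m1 (\<lambda>x. (LINT y|lborel. \<bar>\<rho> t x y\<bar> powr q) powr p) \<and> N2 m1 p q t \<rho> \<noteq> 0"

lemma oriented_atlas_euclidean: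
  "oriented_atlas (euclidean_atlas :: (real ^ 'n, real ^ 'n) chart set)"
proof -
  have inv: "chart_inv (UNIV, id) = (id :: (real ^ 'n) \<Rightarrow> (real ^ 'n))"
    by (simp add: chart_inv_def flip: id_def)
  have tr: "transition (UNIV, id) (UNIV, id) = (id :: (real ^ 'n) \<Rightarrow> (real ^ 'n))"
    by (simp add: transition_def inv)
  have "C1_on UNIV (id :: (real ^ 'n) \<Rightarrow> (real ^ 'n))"
    unfolding C1_on_def
    by (intro exI[of _ "\<lambda>_. id_blinfun"]) (auto simp: id_def intro!: derivative_eq_intros)
  moreover have "frechet_derivative (id :: (real ^ 'n) \<Rightarrow> (real ^ 'n)) (at \<xi>) = id" for \<xi>
    by (simp add: id_def)
  ultimately show ?thesis
    by (auto simp: oriented_atlas_def C1_atlas_def euclidean_atlas_def is_chart_def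
        homeomorphism_def inv tr matrix_id)
qed

lemma coordinate_measure_euclidean:
  fixes m1 :: "'e::euclidean_space measure"
  shows "coordinate_measure euclidean_atlas \<gamma> m1 \<longleftrightarrow>
    \<gamma> (UNIV, id) \<in> borel_measurable borel \<and> (\<forall>x. 0 < \<gamma> (UNIV, id) x) \<and>
    m1 = density lborel (\<lambda>x. ennreal (\<gamma> (UNIV, id) x))"
proof
  assume "coordinate_measure euclidean_atlas \<gamma> m1"
  then have s: "sets m1 = sets borel" and g: "\<gamma> (UNIV, id) \<in> borel_measurable borel"
    and pos: "\<forall>x. 0 < \<gamma> (UNIV, id) x"
    and e: "\<And>S. S \<in> sets borel \<Longrightarrow>
      emeasure m1 S = (\<integral>\<^sup>+\<xi>\<in>S. ennreal (\<gamma> (UNIV, id) \<xi>) \<partial>lborel)"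
    by (auto simp: coordinate_measure_def euclidean_atlas_def set_borel_measurable_def)
  have "m1 = density lborel (\<lambda>x. ennreal (\<gamma> (UNIV, id) x))"
    by (rule measure_eqI) (use s g in \<open>auto simp: e emeasure_density\<close>)
  then show "\<gamma> (UNIV, id) \<in> borel_measurable borel \<and> (\<forall>x. 0 < \<gamma> (UNIV, id) x) \<and>
    m1 = density lborel (\<lambda>x. ennreal (\<gamma> (UNIV, id) x))" using g pos by blast
qed (auto simp: coordinate_measure_def euclidean_atlas_def set_borel_measurable_def
      emeasure_density)

lemma vector_field_euclidean:
  "vector_field euclidean_atlas T U \<longleftrightarrow>
     continuous_on (T \<times> UNIV) (\<lambda>(t, x). U (UNIV, id) t x)"
proof -
  have "transition (UNIV, id) (UNIV, id) = (\<lambda>x::'a. x)"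
    by (simp add: transition_def chart_inv_def id_def fun_eq_iff)
  then show ?thesis
    by (simp add: vector_field_def euclidean_atlas_def)
qed

lemma base_solution_euclidean:
  "base_solution euclidean_atlas U J x \<longleftrightarrow>
     (\<forall>t\<in>J. (x has_vector_derivative U (UNIV, id) t (x t)) (at t within J))"
  by (auto simp: base_solution_def euclidean_atlas_def continuous_on_eq_continuous_within
      intro: has_vector_derivative_continuous)

end

theory Submission imports Defs begin

text \<open>
  The equations for \<open>x\<close> do not involve \<open>y\<close>, so the evolution map from time \<open>t\<close> to time \<open>0\<close> has the
  form \<open>(x, y) \<mapsto> (\<phi> x, h x y)\<close>. Since \<open>V\<close> is divergence free in \<open>y\<close>, each fibre map \<open>h x\<close> preserves
  Lebesgue measure (Liouville), and independence at time \<open>0\<close> gives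
  \<open>\<rho> t x y = \<rho>\<^sub>1 t x * \<rho>\<^sub>2 (h x y)\<close> almost everywhere. Integrating the power \<open>q\<close> over the fibre turns the inner
  integral of \<open>N2\<close> into \<open>(\<rho>\<^sub>1 t x)\<^sup>q\<close> times the integral of \<open>\<rho>\<^sub>2\<^sup>q\<close>, and the quotient by \<open>N1\<close>
  leaves only the latter. Independence is a property of the law of \<open>(X, Y)\<close>, not of the reference measure, so
  \<open>\<rho>\<^sub>2\<close> is the same for every \<open>\<gamma>\<^sub>1\<close>.
\<close>

section \<open>Liouville's theorem for flows with differentiable maps\<close>

text \<open>The base map \<phi> is never differentiated. Its Jacobian and the coefficient of the
  reference measure need no computation, because integrating \<open>\<rho> t\<close> over the fibre
  already yields the density of x(t). The factorisation of \<open>\<rho> t\<close> is therefore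
  obtained weakly: the expectation of a test function of (x(t), y(t)) is computed in two ways, and
  uniqueness of densities gives equality almost everywhere without any regularity of
  \<open>\<rho>\<close>. Only the fibre requires a Jacobian. Along a fixed base trajectory
  \<open>b\<close> the fibre equation becomes a nonautonomous equation with field
  \<open>V t y (b t)\<close>. Its flow inherits the cocycle law from uniqueness and spatial
  differentiability from the evolution maps. The parameter p cancels because N2 raises the fibre
  integral to the power p outside, while N1 carries the product pq: both then contain the same power
  of the marginal. That N1 is nonzero also forces the integral of the power q of the initial fibre
  density to be finite.\<close>

text \<open>A permutation other than the identity moves at least two points, \<open>a\<close> and
  \<open>p a\<close>; deleting the single index \<open>i\<close> leaves an off-diagonal entry in the
  product.\<close>

lemma prod_mat_1_permutes_except_eq_0:
  fixes p :: "'n::finite \<Rightarrow> 'n"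
  assumes "p permutes UNIV" "p \<noteq> id"
  shows "(\<Prod>j\<in>UNIV - {i}. mat 1 $ j $ p j :: real) = 0"
proof -
  obtain a where a: "p a \<noteq> a" using assms(2) by (auto simp: fun_eq_iff)
  have "inj p" using assms(1) by (rule permutes_inj)
  then have b: "p (p a) \<noteq> p a" using a by (auto dest: injD)
  have "\<exists>j. j \<noteq> i \<and> p j \<noteq> j" using a b by (cases "a = i") auto
  then show ?thesis by (force simp: mat_def intro!: prod_zero)
qed

text \<open>Product rule in the Leibniz expansion: where \<open>M t\<close> is the identity, all
  terms except those of the identity permutation vanish, and these add up to the trace. Entrywise
  differentiability at the single point \<open>t\<close> suffices.\<close>

lemma has_real_derivative_det_mat_1:
  fixes M :: "real \<Rightarrow> real^'n^'n" and A :: "real^'n^'n"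
  assumes M: "\<And>i j. ((\<lambda>h. M h $ i $ j) has_real_derivative A $ i $ j) (at t within S)"
    and t: "M t = mat 1"
  shows "((\<lambda>h. det (M h)) has_real_derivative trace A) (at t within S)"
proof -
  have "((\<lambda>h. det (M h)) has_derivative
      (\<lambda>h. \<Sum>p | p permutes (UNIV::'n set). of_int (sign p) *
         (\<Sum>i\<in>UNIV. (A $ i $ p i * h) * (\<Prod>j\<in>UNIV - {i}. M t $ j $ p j)))) (at t within S)"
    unfolding det_def
    by (intro has_derivative_sum has_derivative_mult_right has_derivative_prod)
       (use M in \<open>simp add: has_field_derivative_def\<close>)
  moreover have "(\<Sum>p | p permutes (UNIV::'n set). of_int (sign p) *
         (\<Sum>i\<in>UNIV. (A $ i $ p i * h) * (\<Prod>j\<in>UNIV - {i}. M t $ j $ p j))) = trace A * h" for h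
  proof -
    have "(\<Sum>p | p permutes (UNIV::'n set). of_int (sign p) *
         (\<Sum>i\<in>UNIV. (A $ i $ p i * h) * (\<Prod>j\<in>UNIV - {i}. M t $ j $ p j)))
      = (\<Sum>p | p permutes (UNIV::'n set). if p = id then trace A * h else 0)"
    proof (intro sum.cong refl)
      fix p :: "'n \<Rightarrow> 'n" assume p: "p \<in> {p. p permutes UNIV}"
      show "of_int (sign p) * (\<Sum>i\<in>UNIV. (A $ i $ p i * h) * (\<Prod>j\<in>UNIV - {i}. M t $ j $ p j))
          = (if p = id then trace A * h else 0)"
      proof (cases "p = id")
        case True
        then show ?thesis
          by (simp add: t sign_id trace_def sum_distrib_right mat_def)
      next
        case False
        then show ?thesis
          using p by (simp add: t prod_mat_1_permutes_except_eq_0)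
      qed
    qed
    also have "\<dots> = trace A * h"
      by (simp add: finite_permutations permutes_id[unfolded id_def[symmetric]])
    finally show ?thesis .
  qed
  ultimately show ?thesis by (simp add: has_field_derivative_def)
qed

section \<open>Mean value bounds and confinement of solutions\<close>

lemma norm_diff_le_vector_derivative:
  fixes f :: "real \<Rightarrow> 'a::real_normed_vector"
  assumes "convex S" "\<And>x. x \<in> S \<Longrightarrow> (f has_vector_derivative f' x) (at x within S)"
    and "\<And>x. x \<in> S \<Longrightarrow> norm (f' x) \<le> B" and "x \<in> S" "y \<in> S"
  shows "norm (f x - f y) \<le> B * \<bar>x - y\<bar>"
  unfolding real_norm_def[symmetric]
proof (rule differentiable_bound[OF assms(1), of f "\<lambda>x h. h *\<^sub>R f' x"])
  fix x assume "x \<in> S"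
  then show "onorm (\<lambda>h. h *\<^sub>R f' x) \<le> B"
    using mult_left_mono[OF assms(3)] by (intro onorm_le) (simp add: mult.commute[of B])
qed (use assms in \<open>auto simp: has_vector_derivative_def\<close>)

text \<open>Along \<open>z + h v\<close> the increment is at most \<open>c\<close> times its length,
  and the linearisation error is of smaller order in \<open>h\<close>; dividing by \<open>h\<close>
  leaves the bound for \<open>G v\<close> up to an arbitrary \<open>e\<close>. It carries estimates
  for differences of solutions over to spatial derivatives.\<close>

lemma has_derivative_norm_le:
  assumes g: "(g has_derivative G) (at z)" and "r > 0"
    and b: "\<And>y. norm (y - z) < r \<Longrightarrow> norm (g y - g z) \<le> c * norm (y - z)"
  shows "norm (G v) \<le> c * norm v"
proof (cases "v = 0")
  case True
  then show ?thesis using g by (simp add: linear_0 has_derivative_linear)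
next
  case False
  have lin: "linear G" using g by (rule has_derivative_linear)
  have "norm (G v) \<le> c * norm v + e" if "e > 0" for e
  proof -
    have e': "e / norm v > 0" using that False by simp
    obtain d where d: "d > 0" and D: "\<And>y. norm (y - z) < d \<Longrightarrow>
        norm (g y - g z - G (y - z)) \<le> e / norm v * norm (y - z)"
      using g e' unfolding has_derivative_at_alt by blast
    define h where "h = min d r / (2 * norm v)"
    have h: "h > 0" "h * norm v < d" "h * norm v < r"
      using d \<open>r > 0\<close> False by (auto simp: h_def field_simps min_def)
    have "norm (g (z + h *\<^sub>R v) - g z - G (h *\<^sub>R v)) \<le> e / norm v * (h * norm v)"
      using D[of "z + h *\<^sub>R v"] h by simp
    moreover have "norm (g (z + h *\<^sub>R v) - g z) \<le> c * (h * norm v)"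
      using b[of "z + h *\<^sub>R v"] h by simp
    ultimately have "norm (G (h *\<^sub>R v)) \<le> c * (h * norm v) + e / norm v * (h * norm v)"
      using norm_triangle_ineq4[of "g (z + h *\<^sub>R v) - g z"
          "g (z + h *\<^sub>R v) - g z - G (h *\<^sub>R v)"] by simp
    also have "G (h *\<^sub>R v) = h *\<^sub>R G v" using lin by (simp add: linear_scale)
    also have "c * (h * norm v) + e / norm v * (h * norm v) = h * (c * norm v + e)"
      using False by (simp add: field_simps)
    finally show ?thesis using h by simp
  qed
  then show ?thesis by (rule field_le_epsilon)
qed

text \<open>Until the first exit the speed is at most \<open>M\<close>, so in time less than
  \<open>r / (2 * M)\<close> the solution travels less than \<open>r / 2\<close> from a point within
  \<open>r / 2\<close> of \<open>z\<close>. Segments between \<open>t\<close> and \<tau> treat both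
  time directions at once; the exit time is the point of the compact set \<open>E\<close> nearest to
  \<open>t\<close>.\<close>

lemma solution_stays_in_ball:
  fixes y :: "real \<Rightarrow> 'a::real_normed_vector"
  assumes T: "is_interval T" "t \<in> T"
    and y: "\<And>\<tau>. \<tau> \<in> T \<Longrightarrow> (y has_vector_derivative W \<tau> (y \<tau>)) (at \<tau> within T)"
    and b: "\<And>\<tau> w. \<tau> \<in> T \<Longrightarrow> \<bar>\<tau> - t\<bar> < r \<Longrightarrow> norm (w - z) < r \<Longrightarrow> norm (W \<tau> w) \<le> M"
    and y0: "norm (y t - z) < r / 2" and M: "M > 0"
    and \<tau>: "\<tau> \<in> T" "\<bar>\<tau> - t\<bar> < r" "\<bar>\<tau> - t\<bar> < r / (2 * M)"
  shows "norm (y \<tau> - z) < r"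
proof (rule ccontr)
  assume neg: "\<not> norm (y \<tau> - z) < r"
  have seg: "closed_segment t u \<subseteq> T" if "u \<in> T" for u
    using T that by (simp add: closed_segment_subset is_interval_convex)
  have ycont: "continuous_on (closed_segment t \<tau>) y"
    using y seg[OF \<tau>(1)]
    by (intro continuous_on_subset[OF _ seg[OF \<tau>(1)]])
       (auto simp: continuous_on_eq_continuous_within intro: has_vector_derivative_continuous)
  define E where "E = {u \<in> closed_segment t \<tau>. r \<le> norm (y u - z)}"
  have "closed E" unfolding E_def
    by (intro continuous_on_closed_Collect_le continuous_intros ycont) (auto simp: closed_segment)
  moreover have "E \<subseteq> closed_segment t \<tau>" by (auto simp: E_def)
  ultimately have "compact E"
    using compact_Int_closed[OF compact_segment, of E t \<tau>] by (simp add: Int_absorb1)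
  moreover have "\<tau> \<in> E" using neg by (auto simp: E_def)
  ultimately obtain u where u: "u \<in> E" and umin: "\<And>v. v \<in> E \<Longrightarrow> \<bar>u - t\<bar> \<le> \<bar>v - t\<bar>"
    using continuous_attains_inf[of E "\<lambda>u. \<bar>u - t\<bar>"]
    by (force intro: continuous_intros)
  have uT: "u \<in> T" using u seg[OF \<tau>(1)] by (auto simp: E_def)
  have ule: "\<bar>u - t\<bar> \<le> \<bar>\<tau> - t\<bar>" using \<open>\<tau> \<in> E\<close> umin by blast
  have sub: "closed_segment t u \<subseteq> closed_segment t \<tau>"
    using u by (auto simp: E_def subset_closed_segment)
  have in_ball: "norm (y v - z) < r" if "v \<in> closed_segment t u" "v \<noteq> u" for v
  proof -
    have "\<bar>v - t\<bar> < \<bar>u - t\<bar>" using that by (auto simp: closed_segment_eq_real_ivl split: if_splits)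
    then have "v \<notin> E" using umin by force
    then show ?thesis using that sub by (auto simp: E_def)
  qed
  have "r > 0" using y0 norm_ge_zero[of "y t - z"] by linarith
  then have "u \<noteq> t" using u y0 by (auto simp: E_def)
  have "norm (y v - y t) \<le> M * \<bar>v - t\<bar>" if v: "v \<in> closed_segment t u" "v \<noteq> u" for v
  proof (rule norm_diff_le_vector_derivative[where S = "closed_segment t v" and f' = "\<lambda>x. W x (y x)"])
    fix x assume x: "x \<in> closed_segment t v"
    have xu: "x \<in> closed_segment t u" "x \<noteq> u"
      using x v by (auto simp: closed_segment_eq_real_ivl split: if_splits)
    have "x \<in> T" using xu seg[OF uT] by blast
    moreover have "\<bar>x - t\<bar> < r"
      using xu ule \<tau> by (auto simp: closed_segment_eq_real_ivl split: if_splits)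
    ultimately show "norm (W x (y x)) \<le> M" using b in_ball[OF xu] by blast
    have "closed_segment t v \<subseteq> T"
      using v seg[OF uT] by (intro seg) auto
    then show "(y has_vector_derivative W x (y x)) (at x within closed_segment t v)"
      using y[OF \<open>x \<in> T\<close>] by (rule has_vector_derivative_within_subset[rotated])
  qed auto
  then have le: "norm (y v - y t) \<le> M * \<bar>v - t\<bar>" if "v \<in> open_segment t u" for v
    using that by (auto simp: open_segment_def)
  have cl: "closure (open_segment t u) = closed_segment t u" using \<open>u \<noteq> t\<close> by simp
  \<comment> \<open>At the exit time \<open>u\<close> the solution is outside the open ball, where
    \<open>b\<close> says nothing about the field; the estimate reaches \<open>u\<close> by
    continuity from the open segment.\<close>
  have "norm (y u - y t) \<le> M * \<bar>u - t\<bar>"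
    by (rule continuous_le_on_closure[where S = "open_segment t u" and f="\<lambda>v. norm (y v - y t) - M * \<bar>v - t\<bar>" and a = 0, simplified])
       (use le cl in \<open>auto intro!: continuous_intros continuous_on_subset[OF ycont] simp: cl dest: subsetD[OF sub]\<close>)
  also have "M * \<bar>u - t\<bar> < r / 2"
  proof -
    have "\<bar>u - t\<bar> < r / (2 * M)" using ule \<tau>(3) by linarith
    then show ?thesis using M by (simp add: field_simps)
  qed
  finally have "norm (y u - z) < r"
    using y0 norm_triangle_ineq[of "y u - y t" "y t - z"] by simp
  then show False using u by (auto simp: E_def)
qed

section \<open>Flows of time-dependent fields\<close>

text \<open>This collects what the fibre evolution along a base trajectory satisfies. The field is
  differentiated in space only, and each flow map is merely differentiable at each point. The
  cocycle law is an axiom because it will come from uniqueness for the full system, which cannot be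
  phrased through \<open>W\<close>.\<close>

locale differentiable_flow =
  fixes T :: "real set"
    and W :: "real \<Rightarrow> 'a::euclidean_space \<Rightarrow> 'a"
    and W' :: "real \<Rightarrow> 'a \<Rightarrow> 'a \<Rightarrow>\<^sub>L 'a"
    and \<psi> :: "real \<Rightarrow> real \<Rightarrow> 'a \<Rightarrow> 'a"
  assumes T: "is_interval T"
    and W_cont: "continuous_on (T \<times> UNIV) (\<lambda>(t, y). W t y)"
    and W_deriv: "t \<in> T \<Longrightarrow> (W t has_derivative blinfun_apply (W' t y)) (at y)"
    and W'_cont: "continuous_on (T \<times> UNIV) (\<lambda>(t, y). W' t y)"
    and flow_self: "t \<in> T \<Longrightarrow> \<psi> t t y = y"
    and flow_deriv: "s \<in> T \<Longrightarrow> t \<in> T \<Longrightarrow>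
      ((\<lambda>\<tau>. \<psi> s \<tau> y) has_vector_derivative W t (\<psi> s t y)) (at t within T)"
    and flow_trans: "s \<in> T \<Longrightarrow> t \<in> T \<Longrightarrow> u \<in> T \<Longrightarrow> \<psi> t u (\<psi> s t y) = \<psi> s u y"
    and flow_differentiable: "s \<in> T \<Longrightarrow> t \<in> T \<Longrightarrow> \<psi> s t differentiable at y"
begin

lemma field_close:
  assumes "t \<in> T" "e > 0"
  obtains r where "r > 0"
    "\<And>\<tau> w. \<tau> \<in> T \<Longrightarrow> \<bar>\<tau> - t\<bar> < r \<Longrightarrow> norm (w - z) < r \<Longrightarrow>
        norm (W \<tau> w) \<le> norm (W t z) + 1 \<and> norm (W' \<tau> w - W' t z) \<le> e"
proof -
  have tz: "(t, z) \<in> T \<times> UNIV" using assms by simp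
  obtain d1 where d1: "d1 > 0" "\<And>p. p \<in> T \<times> UNIV \<Longrightarrow> dist p (t, z) < d1 \<Longrightarrow>
      dist (case p of (t, y) \<Rightarrow> W t y) (W t z) < 1"
    using W_cont tz unfolding continuous_on_iff by (metis (no_types, lifting) case_prod_conv zero_less_one)
  obtain d2 where d2: "d2 > 0" "\<And>p. p \<in> T \<times> UNIV \<Longrightarrow> dist p (t, z) < d2 \<Longrightarrow>
      dist (case p of (t, y) \<Rightarrow> W' t y) (W' t z) < e"
    using W'_cont tz \<open>e > 0\<close> unfolding continuous_on_iff by (metis (no_types, lifting) case_prod_conv)
  show thesis
  proof (rule that[of "min d1 d2 / 2"])
    show "min d1 d2 / 2 > 0" using d1 d2 by simp
    fix \<tau> w assume h: "\<tau> \<in> T" "\<bar>\<tau> - t\<bar> < min d1 d2 / 2" "norm (w - z) < min d1 d2 / 2"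
    have "dist (\<tau>, w) (t, z) \<le> dist \<tau> t + dist w z"
      by (simp add: dist_Pair_Pair sqrt_sum_squares_le_sum)
    also have "\<dots> < min d1 d2" using h by (simp add: dist_norm)
    finally have "dist (W \<tau> w) (W t z) < 1" "dist (W' \<tau> w) (W' t z) < e"
      using d1(2)[of "(\<tau>, w)"] d2(2)[of "(\<tau>, w)"] h by auto
    then show "norm (W \<tau> w) \<le> norm (W t z) + 1 \<and> norm (W' \<tau> w - W' t z) \<le> e"
      using norm_triangle_sub[of "W \<tau> w" "W t z"] by (auto simp: dist_norm)
  qed
qed

text \<open>Mean value inequality for \<open>W \<tau> - A\<close> on a ball around \<open>z\<close>,
  where its derivative is at most \<open>e\<close>.\<close>

lemma field_diff_close:
  assumes "\<tau> \<in> T" and b: "\<And>w. norm (w - z) < r \<Longrightarrow> norm (W' \<tau> w - A) \<le> e"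
    and "norm (a - z) < r" "norm (b - z) < r"
  shows "norm (W \<tau> a - W \<tau> b - blinfun_apply A (a - b)) \<le> e * norm (a - b)"
proof -
  have "norm ((W \<tau> a - A a) - (W \<tau> b - A b)) \<le> e * norm (a - b)"
  proof (rule differentiable_bound[where S = "ball z r" and f' = "\<lambda>w. blinfun_apply (W' \<tau> w - A)"])
    fix x assume x: "x \<in> ball z r"
    show "((\<lambda>a. W \<tau> a - A a) has_derivative blinfun_apply (W' \<tau> x - A)) (at x within ball z r)"
      using has_derivative_at_withinI[OF W_deriv[OF \<open>\<tau> \<in> T\<close>]]
      by (auto simp: minus_blinfun.rep_eq fun_diff_def
          intro!: derivative_eq_intros has_derivative_bounded_linear blinfun.bounded_linear_right)
    show "onorm (blinfun_apply (W' \<tau> x - A)) \<le> e"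
      using b[of x] x by (simp add: norm_blinfun.rep_eq dist_norm norm_minus_commute)
  qed (use assms in \<open>auto simp: dist_norm norm_minus_commute\<close>)
  then show ?thesis by (simp add: blinfun.diff_right algebra_simps)
qed


text \<open>The flow maps are not known to be \<open>C\<^sup>1\<close> jointly in time and space, so the variational equation is
  replaced by an estimate for differences of solutions that survives the limit \<open>z' \<longrightarrow> z\<close>.\<close>

lemma flow_difference_estimate:
  assumes t: "t \<in> T" and e: "e > 0"
  obtains d r where "d > 0" "r > 0"
    "\<And>\<tau> z'. \<tau> \<in> T \<Longrightarrow> \<bar>\<tau> - t\<bar> < d \<Longrightarrow> norm (z' - z) < r \<Longrightarrow>
       norm (\<psi> t \<tau> z' - \<psi> t \<tau> z - (z' - z) - (\<tau> - t) *\<^sub>R blinfun_apply (W' t z) (z' - z))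
         \<le> e * \<bar>\<tau> - t\<bar> * norm (z' - z)"
proof -
  define A where "A = W' t z"
  \<comment> \<open>As \<open>e1 \<le> 1\<close>, \<open>C\<close> bounds
    \<open>norm A + e1\<close>, which is a Lipschitz constant of the field near
    \<open>z\<close>.\<close>
  define C where "C = norm A + 1"
  define e1 where "e1 = min 1 (e / 4)"
  define M where "M = norm (W t z) + 1"
  have C: "C \<ge> 1" and M: "M > 0" and e1: "e1 > 0" "e1 \<le> 1" "e1 \<le> e / 4"
    using e by (auto simp: C_def M_def e1_def add_nonneg_pos)
  obtain r where r: "r > 0" and close: "\<And>\<tau> w. \<tau> \<in> T \<Longrightarrow> \<bar>\<tau> - t\<bar> < r \<Longrightarrow> norm (w - z) < r \<Longrightarrow>
        norm (W \<tau> w) \<le> M \<and> norm (W' \<tau> w - A) \<le> e1"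
    using field_close[OF t e1(1), of z] unfolding M_def A_def by blast
  \<comment> \<open>The first two bounds keep both solutions in the ball of radius \<open>r\<close>;
    \<open>1 / (2 * C)\<close> lets the growth of their difference be absorbed; the last makes the
    drift of \<open>A (w u)\<close> away from \<open>A (w t)\<close> at most \<open>e / 4\<close>
    times the maximal difference.\<close>
  define d where "d = min (min r (r / (2 * M))) (min (1 / (2 * C)) (e / (4 * C\<^sup>2)))"
  have "d > 0" using r M C e by (simp add: d_def)
  moreover have "r / 2 > 0" using r by simp
  moreover have "norm (\<psi> t \<tau> z' - \<psi> t \<tau> z - (z' - z) - (\<tau> - t) *\<^sub>R blinfun_apply A (z' - z))
         \<le> e * \<bar>\<tau> - t\<bar> * norm (z' - z)"
    if \<tau>: "\<tau> \<in> T" and \<tau>d: "\<bar>\<tau> - t\<bar> < d" and z': "norm (z' - z) < r / 2" for \<tau> z'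
  proof -
    define S where "S = closed_segment t \<tau>"
    have S: "S \<subseteq> T" unfolding S_def
      using T t \<tau> by (simp add: closed_segment_subset is_interval_convex)
    have S_le: "\<bar>u - t\<bar> \<le> \<bar>\<tau> - t\<bar>" if "u \<in> S" for u
      using that by (auto simp: S_def closed_segment_eq_real_ivl split: if_splits)
    have tS: "t \<in> S" "\<tau> \<in> S" by (auto simp: S_def)
    have stay: "norm (\<psi> t u y - z) < r" if u: "u \<in> S" and y: "norm (y - z) < r / 2" for u y
    proof (rule solution_stays_in_ball[where y = "\<lambda>u. \<psi> t u y", OF T t _ _ _ M])
      show "((\<lambda>\<tau>. \<psi> t \<tau> y) has_vector_derivative W \<tau> (\<psi> t \<tau> y)) (at \<tau> within T)"
        if "\<tau> \<in> T" for \<tau> using flow_deriv[OF t that] .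
      show "norm (W \<tau> w) \<le> M" if "\<tau> \<in> T" "\<bar>\<tau> - t\<bar> < r" "norm (w - z) < r" for \<tau> w
        using close that by blast
      show "norm (\<psi> t t y - z) < r / 2" using y t by (simp add: flow_self)
      show "u \<in> T" "\<bar>u - t\<bar> < r" "\<bar>u - t\<bar> < r / (2 * M)"
        using u S S_le[OF u] \<tau>d by (auto simp: d_def)
    qed
    define w where "w u = \<psi> t u z' - \<psi> t u z" for u
    define w' where "w' u = W u (\<psi> t u z') - W u (\<psi> t u z)" for u
    have wt: "w t = z' - z" using t by (simp add: w_def flow_self)
    have w: "(w has_vector_derivative w' u) (at u within S)" if "u \<in> S" for u
      unfolding w_def w'_def
      by (intro has_vector_derivative_diff has_vector_derivative_within_subset[OF flow_deriv S])
         (use that S t in auto)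
    have w'A: "norm (w' u - A (w u)) \<le> e1 * norm (w u)" if u: "u \<in> S" for u
      unfolding w_def w'_def
    proof (rule field_diff_close)
      show "norm (W' u w - A) \<le> e1" if "norm (w - z) < r" for w
        using close[of u w] that u S S_le[OF u] \<tau>d by (auto simp: d_def)
    qed (use u S stay z' r in auto)
    have "continuous_on S w"
      using w by (auto simp: continuous_on_eq_continuous_within intro: has_vector_derivative_continuous)
    then obtain u0 where u0: "u0 \<in> S" and u0max: "\<And>u. u \<in> S \<Longrightarrow> norm (w u) \<le> norm (w u0)"
      using continuous_attains_sup[of S "\<lambda>u. norm (w u)"] tS
      by (metis S_def compact_segment continuous_on_norm empty_iff)
    \<comment> \<open>Taking the maximum of the difference over the segment replaces Gronwall's
      inequality: \<open>m\<close> is at most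
      \<open>norm (w t) + C * m * \<bar>\<tau> - t\<bar>\<close>, and the last term is at most
      \<open>m / 2\<close>.\<close>
    define m where "m = norm (w u0)"
    have Aw: "norm (A (w u)) \<le> norm A * m" if "u \<in> S" for u
      using norm_blinfun[of A "w u"] u0max[OF that] unfolding m_def
      by (meson mult_left_mono norm_ge_zero order_trans)
    have w'm: "norm (w' u - A (w u)) \<le> e1 * m" if "u \<in> S" for u
      using w'A[OF that] u0max[OF that] e1 unfolding m_def
      by (meson mult_left_mono less_imp_le order_trans)
    have w'C: "norm (w' u) \<le> C * m" if "u \<in> S" for u
    proof -
      have "norm (w' u) \<le> e1 * m + norm A * m"
        using norm_triangle_sub[of "w' u" "A (w u)"] w'm[OF that] Aw[OF that] by simp
      also have "\<dots> \<le> C * m"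
        using e1 by (simp add: C_def m_def algebra_simps mult_left_le_one_le mult_left_le)
      finally show ?thesis .
    qed
    have wC: "norm (w u - w t) \<le> C * m * \<bar>\<tau> - t\<bar>" if u: "u \<in> S" for u
    proof -
      have "norm (w u - w t) \<le> C * m * \<bar>u - t\<bar>"
        by (rule norm_diff_le_vector_derivative[where S = S and f' = w'])
           (use w w'C u tS in \<open>auto simp: S_def\<close>)
      also have "\<dots> \<le> C * m * \<bar>\<tau> - t\<bar>"
        using S_le[OF u] C by (intro mult_left_mono) (auto simp: m_def)
      finally show ?thesis .
    qed
    have "C * \<bar>\<tau> - t\<bar> \<le> 1 / 2"
      using \<tau>d C by (auto simp: d_def field_simps)
    then have "C * m * \<bar>\<tau> - t\<bar> \<le> m / 2"
      using mult_right_mono[of "C * \<bar>\<tau> - t\<bar>" "1/2" m] by (simp add: m_def algebra_simps)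
    then have "norm (w u0 - w t) \<le> m / 2" using wC[OF u0] by simp
    then have m2: "m \<le> 2 * norm (w t)"
      using norm_triangle_sub[of "w u0" "w t"] by (simp add: m_def)
    have C2: "C\<^sup>2 * \<bar>\<tau> - t\<bar> \<le> e / 4"
      using \<tau>d C by (auto simp: d_def field_simps)
    have bound: "norm (w' u - A (w t)) \<le> e * norm (w t)" if u: "u \<in> S" for u
    proof -
      have "norm (A (w u - w t)) \<le> norm A * (C * m * \<bar>\<tau> - t\<bar>)"
        using norm_blinfun[of A "w u - w t"] wC[OF u]
        by (meson mult_left_mono norm_ge_zero order_trans)
      also have "\<dots> \<le> C * (C * m * \<bar>\<tau> - t\<bar>)"
        using C by (intro mult_right_mono) (auto simp: C_def m_def)
      also have "\<dots> = C\<^sup>2 * \<bar>\<tau> - t\<bar> * m" by (simp add: power2_eq_square)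
      also have "\<dots> \<le> e / 4 * m" using C2 by (rule mult_right_mono) (simp add: m_def)
      finally have 1: "norm (A (w u - w t)) \<le> e / 4 * m" .
      have "norm (w' u - A (w u)) \<le> e / 4 * m"
        using w'm[OF u] mult_right_mono[OF e1(3), of m] by (simp add: m_def)
      moreover have "norm (w' u - A (w t)) \<le> norm (w' u - A (w u)) + norm (A (w u - w t))"
        using norm_triangle_ineq[of "w' u - A (w u)" "A (w u - w t)"]
        by (simp add: blinfun.diff_right)
      ultimately have "norm (w' u - A (w t)) \<le> e / 4 * m + e / 4 * m"
        using 1 by linarith
      also have "\<dots> \<le> e * norm (w t)" using mult_left_mono[OF m2, of "e / 2"] e by simp
      finally show ?thesis .
    qed
    \<comment> \<open>Mean value bound for \<open>w\<close> minus its expected linear part. Two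
      contributions of \<open>e / 4 * m\<close>, with \<open>m\<close> at most twice
      \<open>norm (w t)\<close>, give the constant \<open>e\<close>.\<close>
    have "norm ((w \<tau> - \<tau> *\<^sub>R A (w t)) - (w t - t *\<^sub>R A (w t))) \<le> e * norm (w t) * \<bar>\<tau> - t\<bar>"
      by (rule norm_diff_le_vector_derivative[where S = S and f' = "\<lambda>u. w' u - A (w t)"
            and f = "\<lambda>u. w u - u *\<^sub>R A (w t)"])
         (use bound tS in \<open>auto simp: S_def[symmetric] convex_closed_segment[of t \<tau>, folded S_def]
            intro!: has_vector_derivative_diff w derivative_eq_intros\<close>)
    then show ?thesis
      by (simp add: wt) (simp add: w_def algebra_simps)
  qed
  ultimately show thesis using that unfolding A_def by blast
qed

text \<open>In the difference estimate \<open>d\<close> and \<open>r\<close> do not depend on the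
  second starting point, so for fixed \<tau> that point may tend to \<open>z\<close> and the same
  constant bounds the spatial derivative.\<close>

lemma flow_derivative_estimate:
  assumes t: "t \<in> T" and e: "e > 0"
  obtains d where "d > 0"
    "\<And>\<tau> v. \<tau> \<in> T \<Longrightarrow> \<bar>\<tau> - t\<bar> < d \<Longrightarrow>
       norm (frechet_derivative (\<psi> t \<tau>) (at z) v - v - (\<tau> - t) *\<^sub>R blinfun_apply (W' t z) v)
         \<le> e * \<bar>\<tau> - t\<bar> * norm v"
proof -
  obtain d r where d: "d > 0" "r > 0" and est:
    "\<And>\<tau> z'. \<tau> \<in> T \<Longrightarrow> \<bar>\<tau> - t\<bar> < d \<Longrightarrow> norm (z' - z) < r \<Longrightarrow>
       norm (\<psi> t \<tau> z' - \<psi> t \<tau> z - (z' - z) - (\<tau> - t) *\<^sub>R blinfun_apply (W' t z) (z' - z))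
         \<le> e * \<bar>\<tau> - t\<bar> * norm (z' - z)"
    using flow_difference_estimate[OF t e, of z] by blast
  have "norm (frechet_derivative (\<psi> t \<tau>) (at z) v - v - (\<tau> - t) *\<^sub>R W' t z v)
      \<le> e * \<bar>\<tau> - t\<bar> * norm v" if \<tau>: "\<tau> \<in> T" "\<bar>\<tau> - t\<bar> < d" for \<tau> v
  proof (rule has_derivative_norm_le[of "\<lambda>y. \<psi> t \<tau> y - y - (\<tau> - t) *\<^sub>R W' t z y" _ z, OF _ d(2)])
    have "(\<psi> t \<tau> has_derivative frechet_derivative (\<psi> t \<tau>) (at z)) (at z)"
      using flow_differentiable[OF t \<tau>(1)] by (simp add: frechet_derivative_works)
    then show "((\<lambda>y. \<psi> t \<tau> y - y - (\<tau> - t) *\<^sub>R W' t z y) has_derivative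
        (\<lambda>v. frechet_derivative (\<psi> t \<tau>) (at z) v - v - (\<tau> - t) *\<^sub>R W' t z v)) (at z)"
      by (auto intro!: derivative_eq_intros
          bounded_linear.has_derivative[OF blinfun.bounded_linear_right])
    fix y assume "norm (y - z) < r"
    from est[OF \<tau> this] show "norm (\<psi> t \<tau> y - y - (\<tau> - t) *\<^sub>R W' t z y -
        (\<psi> t \<tau> z - z - (\<tau> - t) *\<^sub>R W' t z z)) \<le> e * \<bar>\<tau> - t\<bar> * norm (y - z)"
      by (simp add: blinfun.diff_right algebra_simps)
  qed
  then show thesis using that d by blast
qed

end

section \<open>The Jacobian determinant of a flow\<close>

text \<open>At \<tau> = \<open>t\<close> the flow map is the identity, and the derivative estimate
  says that each entry of its spatial derivative has the corresponding entry of
  \<open>W' t z\<close> as time derivative there.\<close>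

lemma flow_det_has_derivative:
  fixes \<psi> :: "real \<Rightarrow> real \<Rightarrow> real^'n \<Rightarrow> real^'n"
  assumes "differentiable_flow T W W' \<psi>" and t: "t \<in> T"
  shows "((\<lambda>\<tau>. det (matrix (frechet_derivative (\<psi> t \<tau>) (at z)))) has_real_derivative
     trace (matrix (blinfun_apply (W' t z)))) (at t within T)"
proof (rule has_real_derivative_det_mat_1)
  interpret differentiable_flow T W W' \<psi> by fact
  have "\<psi> t t = (\<lambda>y. y)" using t by (auto simp: flow_self)
  then have D: "frechet_derivative (\<psi> t t) (at z) = (\<lambda>v. v)" by simp
  then show "matrix (frechet_derivative (\<psi> t t) (at z)) = mat 1"
    by (simp add: matrix_id_mat_1[unfolded id_def])
  fix i j
  let ?v = "axis j 1 :: real^'n"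
  show "((\<lambda>\<tau>. matrix (frechet_derivative (\<psi> t \<tau>) (at z)) $ i $ j) has_real_derivative
     matrix (blinfun_apply (W' t z)) $ i $ j) (at t within T)"
    unfolding has_field_derivative_def has_derivative_within_alt
  proof (intro conjI allI impI)
    fix e :: real assume "e > 0"
    then obtain d where d: "d > 0" and est: "\<And>\<tau>. \<tau> \<in> T \<Longrightarrow> \<bar>\<tau> - t\<bar> < d \<Longrightarrow>
       norm (frechet_derivative (\<psi> t \<tau>) (at z) ?v - ?v - (\<tau> - t) *\<^sub>R W' t z ?v) \<le> e * \<bar>\<tau> - t\<bar>"
      using flow_derivative_estimate[OF t, of e z] by (metis mult.right_neutral norm_axis_1)
    show "\<exists>d>0. \<forall>\<tau>\<in>T. norm (\<tau> - t) < d \<longrightarrow>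
        norm (matrix (frechet_derivative (\<psi> t \<tau>) (at z)) $ i $ j
          - matrix (frechet_derivative (\<psi> t t) (at z)) $ i $ j
          - matrix (blinfun_apply (W' t z)) $ i $ j * (\<tau> - t)) \<le> e * norm (\<tau> - t)"
    proof (intro exI conjI ballI impI, rule d)
      fix \<tau> assume \<tau>: "\<tau> \<in> T" "norm (\<tau> - t) < d"
      from component_le_norm_cart[of
          "frechet_derivative (\<psi> t \<tau>) (at z) ?v - ?v - (\<tau> - t) *\<^sub>R W' t z ?v" i]
      have "\<bar>(frechet_derivative (\<psi> t \<tau>) (at z) ?v - ?v - (\<tau> - t) *\<^sub>R W' t z ?v) $ i\<bar>
          \<le> e * \<bar>\<tau> - t\<bar>"
        using est[of \<tau>] \<tau> by simp
      then show "norm (matrix (frechet_derivative (\<psi> t \<tau>) (at z)) $ i $ j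
          - matrix (frechet_derivative (\<psi> t t) (at z)) $ i $ j
          - matrix (blinfun_apply (W' t z)) $ i $ j * (\<tau> - t)) \<le> e * norm (\<tau> - t)"
        by (simp add: D matrix_def mult.commute)
    qed
  qed (rule bounded_linear_mult_right)
qed

text \<open>By the cocycle property the derivative of the Jacobian at time \<open>t\<close> only needs the one at the starting
  time of the flow from \<open>t\<close>, where the flow map is the identity.\<close>

lemma flow_det_eq_1:
  fixes \<psi> :: "real \<Rightarrow> real \<Rightarrow> real^'n \<Rightarrow> real^'n"
  assumes flow: "differentiable_flow T W W' \<psi>"
    and tr: "\<And>t y. t \<in> T \<Longrightarrow> trace (matrix (blinfun_apply (W' t y))) = 0"
    and s: "s \<in> T" and t: "t \<in> T"
  shows "det (matrix (frechet_derivative (\<psi> s t) (at y))) = 1"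
proof -
  interpret differentiable_flow T W W' \<psi> by fact
  define J where "J \<tau> = det (matrix (frechet_derivative (\<psi> s \<tau>) (at y)))" for \<tau>
  have lin: "linear (frechet_derivative (\<psi> a b) (at x))" if "a \<in> T" "b \<in> T" for a b x
    using flow_differentiable[OF that] by (rule linear_frechet_derivative)
  have "(J has_real_derivative 0) (at t within T)" if t: "t \<in> T" for t
  proof -
    define z where "z = \<psi> s t y"
    have "((\<lambda>\<tau>. det (matrix (frechet_derivative (\<psi> t \<tau>) (at z))) * J t) has_real_derivative 0)
        (at t within T)"
      using DERIV_cmult_right[OF flow_det_has_derivative[OF flow t, of z], of "J t"] tr[OF t] by simp
    moreover have "det (matrix (frechet_derivative (\<psi> t \<tau>) (at z))) * J t = J \<tau>" if \<tau>: "\<tau> \<in> T" for \<tau>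
    proof -
      have "\<psi> s \<tau> = \<psi> t \<tau> \<circ> \<psi> s t" using flow_trans[OF s t \<tau>] by (simp add: fun_eq_iff)
      then have "frechet_derivative (\<psi> s \<tau>) (at y) =
          frechet_derivative (\<psi> t \<tau>) (at z) \<circ> frechet_derivative (\<psi> s t) (at y)"
        using frechet_derivative_compose flow_differentiable s t \<tau> by (metis z_def)
      then show ?thesis
        by (simp add: J_def matrix_compose lin s t \<tau> det_mul)
    qed
    ultimately show ?thesis
      by (rule has_field_derivative_transform_within[OF _ zero_less_one t]) simp
  qed
  then obtain c where c: "\<And>\<tau>. \<tau> \<in> T \<Longrightarrow> J \<tau> = c"
    using has_field_derivative_zero_constant[OF is_interval_convex[OF T]] by blast
  have "\<psi> s s = (\<lambda>y. y)" using s by (auto simp: flow_self)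
  then have "J s = 1" by (simp add: J_def matrix_id_mat_1[unfolded id_def])
  then show ?thesis using c[OF s] c[OF t] by (simp add: J_def)
qed

section \<open>Lebesgue measure under maps with unit Jacobian\<close>

text \<open>A push-forward is computed from preimages, whereas change of variables measures images;
  so the Jacobian is required of the inverse \<open>f\<close>, and the preimage of a box under
  \<open>g\<close> is its image under \<open>f\<close>. Injectivity and pointwise differentiability
  of \<open>f\<close> suffice for that formula.\<close>

lemma distr_lborel_inverse_of_det_1:
  fixes f g :: "real^'n::{finite,wellorder} \<Rightarrow> real^'n::_"
  assumes f: "\<And>x. f differentiable at x"
    and det: "\<And>x. det (matrix (frechet_derivative f (at x))) = 1"
    and inv: "\<And>x. g (f x) = x" "\<And>x. f (g x) = x"
    and g: "g \<in> borel \<rightarrow>\<^sub>M borel"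
  shows "distr lborel borel g = lborel"
proof (rule lborel_eqI[symmetric])
  fix l u :: "real^'n::_" assume le: "\<And>b. b \<in> Basis \<Longrightarrow> l \<bullet> b \<le> u \<bullet> b"
  have eq: "g -` box l u = f ` box l u"
  proof safe
    fix x assume "g x \<in> box l u"
    then have "f (g x) \<in> f ` box l u" by (rule imageI)
    then show "x \<in> f ` box l u" by (simp add: inv)
  qed (simp add: inv)
  have meas: "g -` box l u \<in> sets borel"
    using measurable_sets[OF g, of "box l u"] by simp
  have "((\<lambda>x. \<bar>det (matrix (frechet_derivative f (at x)))\<bar>) has_integral measure lebesgue (box l u)) (box l u)"
    using has_integral_measure_lborel[OF _ emeasure_bounded_finite[OF bounded_box], of l u]
    by (simp add: det)
  then have *: "f ` box l u \<in> lmeasurable" "measure lebesgue (f ` box l u) = measure lebesgue (box l u)"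
    using has_measure_differentiable_image[of "box l u" f "\<lambda>x. frechet_derivative f (at x)"]
      f inj_on_inverseI[of "box l u" g f] inv
    by (auto simp: frechet_derivative_works has_derivative_at_withinI)
  have "emeasure (distr lborel borel g) (box l u) = emeasure lborel (g -` box l u)"
    using g by (simp add: emeasure_distr)
  also have "\<dots> = emeasure lebesgue (f ` box l u)"
    using meas by (simp flip: eq)
  also have "\<dots> = ennreal (measure lebesgue (box l u))"
    using * by (simp add: emeasure_eq_measure2)
  also have "\<dots> = (\<Prod>b\<in>Basis. (u - l) \<bullet> b)"
    using le by (simp add: measure_lborel_box_eq)
  finally show "emeasure (distr lborel borel g) (box l u) = (\<Prod>b\<in>Basis. (u - l) \<bullet> b)" .
qed simp

text \<open>The change of variables theorem of HOL-Analysis requires a well-ordered index type; \<open>'k\<close> is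
  only finite, so it is replaced by a copy of an initial segment of the naturals.\<close>

typedef (overloaded) 'k index = "{..<CARD('k::finite)}"
  by (rule exI[of _ 0]) simp

setup_lifting type_definition_index

instantiation index :: (finite) "{finite,wellorder}"
begin

lift_definition less_eq_index :: "'a index \<Rightarrow> 'a index \<Rightarrow> bool" is "(\<le>)" .
lift_definition less_index :: "'a index \<Rightarrow> 'a index \<Rightarrow> bool" is "(<)" .

instance
proof
  show "finite (UNIV :: 'a index set)"
    by (rule type_definition.univ[OF type_definition_index, THEN ssubst]) simp
  fix P :: "'a index \<Rightarrow> bool" and a
  assume step: "\<And>x. (\<And>y. y < x \<Longrightarrow> P y) \<Longrightarrow> P x"
  show "P a"
    by (induction a rule: measure_induct_rule[where f = Rep_index])
       (auto intro: step simp: less_index.rep_eq)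
qed (transfer; auto)+

end

lemma ex_bij_index: "\<exists>\<pi> :: 'k::finite index \<Rightarrow> 'k. bij \<pi>"
proof -
  have "bij_betw Rep_index (UNIV :: 'k index set) {..<CARD('k)}"
    by (metis bij_betw_def inj_on_def Rep_index_inject type_definition.Rep_range[OF type_definition_index])
  moreover obtain h where "bij_betw h {..<CARD('k)} (UNIV :: 'k set)"
    using ex_bij_betw_nat_finite[of "UNIV :: 'k set"] by (auto simp: atLeast0LessThan)
  ultimately show ?thesis using bij_betw_trans by blast
qed

section \<open>Relabelling of coordinates\<close>

definition reindex :: "('n \<Rightarrow> 'k) \<Rightarrow> real^'k \<Rightarrow> real^'n" where
  "reindex \<pi> y = (\<chi> i. y $ \<pi> i)"

lemma reindex_nth [simp]: "reindex \<pi> y $ i = y $ \<pi> i"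
  by (simp add: reindex_def)

lemma linear_reindex: "linear (reindex \<pi>)"
  by (rule linearI) (simp_all add: vec_eq_iff)

lemma bounded_linear_reindex: "bounded_linear (reindex \<pi>)"
  using linear_reindex by (rule linear_linear[THEN iffD2])

lemma measurable_reindex [measurable]: "reindex \<pi> \<in> borel \<rightarrow>\<^sub>M borel"
  by (intro borel_measurable_continuous_onI linear_continuous_on bounded_linear_reindex)

lemma reindex_inv [simp]:
  assumes "bij \<pi>"
  shows "reindex \<pi> (reindex (inv \<pi>) y) = y" "reindex (inv \<pi>) (reindex \<pi> z) = z"
  using assms by (auto simp: vec_eq_iff bij_is_inj bij_is_surj surj_f_inv_f)

text \<open>The preimage of a box is the box with permuted sides, and the product of the side
  lengths does not see the order.\<close>

lemma distr_lborel_reindex: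
  fixes \<pi> :: "'n::finite \<Rightarrow> 'k::finite"
  assumes "bij \<pi>"
  shows "distr lborel borel (reindex \<pi>) = lborel"
proof (rule lborel_eqI[symmetric])
  fix l u :: "real^'n::_" assume le: "\<And>b. b \<in> Basis \<Longrightarrow> l \<bullet> b \<le> u \<bullet> b"
  let ?r = "reindex (inv \<pi>)"
  have le': "l $ i \<le> u $ i" for i
    using le[of "axis i 1"] by (simp add: axis_in_Basis_iff inner_axis)
  have sur: "(\<forall>i. P i (\<pi> i)) = (\<forall>k. P (inv \<pi> k) k)" for P
    using assms by (metis bij_inv_eq_iff)
  have eq: "reindex \<pi> -` box l u = box (?r l) (?r u)"
    by (rule set_eqI) (simp add: mem_box_cart sur[of "\<lambda>i k. l $ i < _ $ k \<and> _ $ k < u $ i"])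
  have prod: "(\<Prod>b\<in>Basis. (b' - a) \<bullet> b) = (\<Prod>i\<in>UNIV. b' $ i - a $ i)" for a b' :: "real^'m::finite"
    by (simp add: Basis_vec_def UNION_singleton_eq_range prod.reindex inj_on_def axis_eq_axis inner_axis)
  have "emeasure (distr lborel borel (reindex \<pi>)) (box l u) = emeasure lborel (box (?r l) (?r u))"
    by (simp add: emeasure_distr eq)
  also have "\<dots> = ennreal (\<Prod>k\<in>UNIV. u $ inv \<pi> k - l $ inv \<pi> k)"
  proof (subst emeasure_lborel_box)
    show "?r l \<bullet> b \<le> ?r u \<bullet> b" if "b \<in> Basis" for b
      using that le' by (auto simp: Basis_vec_def inner_axis)
  qed (simp add: prod)
  also have "(\<Prod>k\<in>UNIV. u $ inv \<pi> k - l $ inv \<pi> k) = (\<Prod>i\<in>UNIV. u $ i - l $ i)"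
    by (rule prod.reindex_bij_betw) (use assms in \<open>simp add: bij_imp_bij_inv\<close>)
  finally show "emeasure (distr lborel borel (reindex \<pi>)) (box l u) = (\<Prod>b\<in>Basis. (u - l) \<bullet> b)"
    by (simp add: prod)
qed simp


lemma reindex_axis: "bij \<pi> \<Longrightarrow> reindex (inv \<pi>) (axis j 1) = axis (\<pi> j) 1"
  by (simp add: vec_eq_iff axis_def bij_inv_eq_iff eq_commute)

text \<open>Conjugation by a linear isomorphism respects every clause of the locale; it moves the
  flow to a copy of the space with another index type.\<close>

lemma differentiable_flow_reindex:
  fixes \<psi> :: "real \<Rightarrow> real \<Rightarrow> real^'k \<Rightarrow> real^'k" and \<pi> :: "'n::finite \<Rightarrow> 'k"
  assumes "differentiable_flow T W W' \<psi>" and \<pi>: "bij \<pi>"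
  shows "differentiable_flow T (\<lambda>t y. reindex \<pi> (W t (reindex (inv \<pi>) y)))
    (\<lambda>t y. Blinfun (reindex \<pi>) o\<^sub>L W' t (reindex (inv \<pi>) y) o\<^sub>L Blinfun (reindex (inv \<pi>)))
    (\<lambda>s t y. reindex \<pi> (\<psi> s t (reindex (inv \<pi>) y)))"
proof -
  interpret differentiable_flow T W W' \<psi> by fact
  note bl = bounded_linear_reindex
  note [simp] = bounded_linear_Blinfun_apply[OF bl]
  have pair: "continuous_on (T \<times> UNIV) (\<lambda>(t, y). (t, reindex (inv \<pi>) y))"
    unfolding case_prod_unfold
    by (intro continuous_intros bounded_linear.continuous_on[OF bl])
  show ?thesis
  proof
    show "continuous_on (T \<times> UNIV) (\<lambda>(t, y). reindex \<pi> (W t (reindex (inv \<pi>) y)))"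
      using bounded_linear.continuous_on[OF bl continuous_on_compose2[OF W_cont pair]]
      by (simp add: case_prod_unfold image_subset_iff)
    show "continuous_on (T \<times> UNIV) (\<lambda>(t, y). Blinfun (reindex \<pi>) o\<^sub>L W' t (reindex (inv \<pi>) y)
        o\<^sub>L Blinfun (reindex (inv \<pi>)))"
      using continuous_on_compose2[OF W'_cont pair]
      by (auto simp: case_prod_unfold image_subset_iff intro!: continuous_intros)
    fix t y assume t: "t \<in> T"
    have Q: "(reindex (inv \<pi>) has_derivative reindex (inv \<pi>)) (at y)"
      using bl by (rule bounded_linear_imp_has_derivative)
    show "((\<lambda>y. reindex \<pi> (W t (reindex (inv \<pi>) y))) has_derivative blinfun_apply
        (Blinfun (reindex \<pi>) o\<^sub>L W' t (reindex (inv \<pi>) y) o\<^sub>L Blinfun (reindex (inv \<pi>)))) (at y)"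
      using bounded_linear.has_derivative[OF bl has_derivative_compose[OF Q W_deriv[OF t]]]
      by (simp add: blinfun_compose.rep_eq o_def)
    show "reindex \<pi> (\<psi> t t (reindex (inv \<pi>) y)) = y"
      using t \<pi> by (simp add: flow_self)
    fix s assume s: "s \<in> T"
    show "((\<lambda>\<tau>. reindex \<pi> (\<psi> s \<tau> (reindex (inv \<pi>) y))) has_vector_derivative
        reindex \<pi> (W t (reindex (inv \<pi>) (reindex \<pi> (\<psi> s t (reindex (inv \<pi>) y)))))) (at t within T)"
      using bounded_linear.has_vector_derivative[OF bl flow_deriv[OF s t]] \<pi> by simp
    show "(\<lambda>y. reindex \<pi> (\<psi> s t (reindex (inv \<pi>) y))) differentiable at y"
      using bounded_linear.has_derivative[OF bl has_derivative_compose[OF Q]]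
        flow_differentiable[OF s t]
      unfolding differentiable_def by blast
  qed (use T \<pi> in \<open>simp_all add: flow_trans\<close>)
qed

text \<open>Relabelling reorders the diagonal entries, so the trace stays zero, and it preserves
  Lebesgue measure; the result for the well-ordered copy therefore transfers back.\<close>

lemma flow_distr_lborel:
  fixes \<psi> :: "real \<Rightarrow> real \<Rightarrow> real^'k \<Rightarrow> real^'k"
  assumes flow: "differentiable_flow T W W' \<psi>"
    and tr: "\<And>t y. t \<in> T \<Longrightarrow> trace (matrix (blinfun_apply (W' t y))) = 0"
    and s: "s \<in> T" and t: "t \<in> T"
  shows "distr lborel borel (\<psi> s t) = lborel"
proof -
  obtain \<pi> :: "'k index \<Rightarrow> 'k" where \<pi>: "bij \<pi>" using ex_bij_index by blast
  let ?R = "reindex \<pi>" and ?Q = "reindex (inv \<pi>)"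
  define g where "g s t y = ?R (\<psi> s t (?Q y))" for s t y
  have fg: "differentiable_flow T (\<lambda>t y. ?R (W t (?Q y)))
    (\<lambda>t y. Blinfun ?R o\<^sub>L W' t (?Q y) o\<^sub>L Blinfun ?Q) g"
    unfolding g_def[abs_def] using flow \<pi> by (rule differentiable_flow_reindex)
  interpret G: differentiable_flow T "\<lambda>t y. ?R (W t (?Q y))"
      "\<lambda>t y. Blinfun ?R o\<^sub>L W' t (?Q y) o\<^sub>L Blinfun ?Q" g by (rule fg)
  have trg: "trace (matrix (blinfun_apply (Blinfun ?R o\<^sub>L W' t (?Q y) o\<^sub>L Blinfun ?Q))) = 0"
    if "t \<in> T" for t y
  proof -
    have "trace (matrix (blinfun_apply (Blinfun ?R o\<^sub>L W' t (?Q y) o\<^sub>L Blinfun ?Q)))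
       = (\<Sum>i\<in>UNIV. W' t (?Q y) (axis (\<pi> i) 1) $ \<pi> i)"
      by (simp add: trace_def matrix_def bounded_linear_Blinfun_apply[OF bounded_linear_reindex]
          reindex_axis \<pi>)
    also have "\<dots> = (\<Sum>k\<in>UNIV. W' t (?Q y) (axis k 1) $ k)"
      using \<pi> by (rule sum.reindex_bij_betw)
    also have "\<dots> = trace (matrix (blinfun_apply (W' t (?Q y))))"
      by (simp add: trace_def matrix_def)
    finally show ?thesis using tr[OF that] by simp
  qed
  have meas: "g s t \<in> borel \<rightarrow>\<^sub>M borel"
    using G.flow_differentiable[OF s t]
    by (intro borel_measurable_continuous_onI)
       (simp add: continuous_on_eq_continuous_at differentiable_imp_continuous_within)
  have inv: "g t s (g s t y) = y" "g s t (g t s y) = y" for y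
    using G.flow_trans s t G.flow_self by auto
  \<comment> \<open>The unit Jacobian is used for the backward map \<open>g t s\<close>, the inverse
    of \<open>g s t\<close>.\<close>
  have lg: "distr lborel borel (g s t) = lborel"
    by (rule distr_lborel_inverse_of_det_1[OF _ _ inv(2) inv(1) meas])
       (use G.flow_differentiable flow_det_eq_1[OF fg trg] s t in auto)
  have eq: "\<psi> s t = ?Q \<circ> (g s t \<circ> ?R)"
    using \<pi> by (simp add: g_def fun_eq_iff)
  have "distr lborel borel (\<psi> s t) = distr (distr (distr lborel borel ?R) borel (g s t)) borel ?Q"
    using meas by (simp add: eq distr_distr comp_assoc)
  then show ?thesis
    using \<pi> by (simp add: distr_lborel_reindex lg bij_imp_bij_inv)
qed

section \<open>The evolution on the fibres\<close>

lemma chart_inv_coords: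
  "is_chart c \<Longrightarrow> x \<in> chart_dom c \<Longrightarrow> chart_inv c (coords c x) = x"
  by (auto simp: is_chart_def homeomorphism_def)

lemma chart_inv_prod_euclidean:
  assumes c: "is_chart c" and x: "x \<in> chart_dom c"
  shows "chart_inv (chart_dom c \<times> UNIV, map_prod (coords c) id) (coords c x, y) = (x, y)"
  unfolding chart_inv_def
proof (rule inv_into_f_eq)
  have "inj_on (coords c) (chart_dom c)"
    by (rule inj_on_inverseI) (rule chart_inv_coords[OF c])
  then show "inj_on (coords (chart_dom c \<times> UNIV, map_prod (coords c) id))
      (chart_dom (chart_dom c \<times> UNIV, map_prod (coords c) id))"
    by (auto simp: inj_on_def)
qed (use x in auto)

text \<open>In product charts around the point and its image, fixing the first coordinate and taking
  the second component gives the fibre map itself. This holds for every fibre point, because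
  \<open>coords pd\<close> acts as the identity on the second component even outside its chart
  domain.\<close>

lemma C1_map_fibre_differentiable:
  fixes f :: "'m::topological_space \<times> 'f::euclidean_space \<Rightarrow> 'n::topological_space \<times> 'g::euclidean_space"
    and A :: "('m, 'e::euclidean_space) chart set" and B :: "('n, 'h::euclidean_space) chart set"
  assumes A: "C1_atlas A" and B: "C1_atlas B"
    and f: "C1_map (prod_atlas A euclidean_atlas) (prod_atlas B euclidean_atlas) f"
  shows "(\<lambda>y. snd (f (x, y))) differentiable at y"
proof -
  obtain c where c: "c \<in> A" "x \<in> chart_dom c" "is_chart c"
    using A unfolding C1_atlas_def by blast
  obtain d where d: "d \<in> B" "fst (f (x, y)) \<in> chart_dom d"
    using B unfolding C1_atlas_def by blast
  define pc where "pc = (chart_dom c \<times> (UNIV :: 'f set), map_prod (coords c) (id :: 'f \<Rightarrow> 'f))"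
  define pd where "pd = (chart_dom d \<times> (UNIV :: 'g set), map_prod (coords d) (id :: 'g \<Rightarrow> 'g))"
  have "pc \<in> prod_atlas A euclidean_atlas" "pd \<in> prod_atlas B euclidean_atlas"
    using c d by (force simp: prod_atlas_def euclidean_atlas_def pc_def pd_def)+
  then have "C1_on (coords pc ` (chart_dom pc \<inter> f -` chart_dom pd)) (coords pd \<circ> f \<circ> chart_inv pc)"
    using f by (auto simp: C1_map_def)
  moreover have "(coords c x, y) \<in> coords pc ` (chart_dom pc \<inter> f -` chart_dom pd)"
    by (rule image_eqI[of _ _ "(x, y)"]) (use c d in \<open>auto simp: pc_def pd_def mem_Times_iff\<close>)
  ultimately obtain D where D: "(coords pd \<circ> f \<circ> chart_inv pc has_derivative blinfun_apply D)
      (at (coords c x, y))"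
    unfolding C1_on_def by blast
  have "((\<lambda>y. (coords c x, y)) has_derivative (\<lambda>v. (0, v))) (at y)"
    by (intro derivative_eq_intros) auto
  from has_derivative_snd[OF has_derivative_compose[OF this D]]
  have "((\<lambda>y. snd ((coords pd \<circ> f \<circ> chart_inv pc) (coords c x, y))) has_derivative
      (\<lambda>v. snd (D (0, v)))) (at y)" .
  moreover have "chart_inv pc (coords c x, y') = (x, y')" for y'
    unfolding pc_def using c by (simp add: chart_inv_prod_euclidean)
  ultimately show ?thesis
    by (auto simp: differentiable_def pd_def)
qed

lemma trace_eq_divergence:
  fixes F :: "real^'k \<Rightarrow> real^'k"
  assumes F: "(F has_derivative F') (at y)"
  shows "trace (matrix F') = divergence F y"
  unfolding trace_def matrix_def divergence_def
proof (intro sum.cong refl)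
  fix j :: 'k
  have "((\<lambda>s. y + s *\<^sub>R axis j 1) has_derivative (\<lambda>s. s *\<^sub>R axis j 1)) (at 0)"
    by (auto intro!: derivative_eq_intros)
  moreover have "(F has_derivative F') (at (y + 0 *\<^sub>R axis j 1))" using F by simp
  ultimately have "((\<lambda>s. F (y + s *\<^sub>R axis j 1)) has_derivative (\<lambda>s. F' (s *\<^sub>R axis j 1))) (at 0)"
    by (rule has_derivative_compose)
  then have "((\<lambda>s. F (y + s *\<^sub>R axis j 1) $ j) has_derivative (\<lambda>s. F' (s *\<^sub>R axis j 1) $ j)) (at 0)"
    by (rule bounded_linear.has_derivative[OF bounded_linear_vec_nth])
  then have "((\<lambda>s. F (y + s *\<^sub>R axis j 1) $ j) has_real_derivative F' (axis j 1) $ j) (at 0)"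
    using F by (simp add: has_field_derivative_def linear_scale has_derivative_linear mult.commute[of _ "F' _ $ _"])
  then show "(\<chi> i j. F' (axis j 1) $ i) $ j $ j = deriv (\<lambda>s. F (y + s *\<^sub>R axis j 1) $ j) 0"
    by (simp add: DERIV_imp_deriv)
qed

context
  fixes A :: "('m::topological_space, 'e::euclidean_space) chart set"
    and U :: "('m, 'e) chart \<Rightarrow> real \<Rightarrow> 'e \<Rightarrow> 'e"
    and V :: "real \<Rightarrow> real^'k \<Rightarrow> 'm \<Rightarrow> real^'k"
    and T :: "real set"
    and \<Phi> :: "real \<Rightarrow> real \<Rightarrow> 'm \<times> (real^'k) \<Rightarrow> 'm \<times> (real^'k)"
  assumes A: "C1_atlas A" and T: "is_interval T"
    and uniq: "unique_solutions A U V T" and evol: "evolution A U V T \<Phi>"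
begin

lemma evolution_solution: "s \<in> T \<Longrightarrow> system_solution A U V T (\<lambda>t. \<Phi> s t z)"
  using evol unfolding evolution_def by blast

lemma evolution_self: "s \<in> T \<Longrightarrow> \<Phi> s s z = z"
  using evol unfolding evolution_def by blast

lemma evolution_trans:
  assumes "s \<in> T" "t \<in> T" "u \<in> T"
  shows "\<Phi> t u (\<Phi> s t z) = \<Phi> s u z"
proof -
  have "\<forall>z z'. system_solution A U V T z \<and> system_solution A U V T z' \<and> z t = z' t \<longrightarrow>
        (\<forall>u\<in>T. z u = z' u)"
    using uniq T assms unfolding unique_solutions_def by blast
  from this[rule_format, of "\<lambda>u. \<Phi> t u (\<Phi> s t z)" "\<lambda>u. \<Phi> s u z"] show ?thesis
    using assms by (simp add: evolution_solution evolution_self)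
qed

text \<open>The first component solves the closed base equations, so uniqueness for these alone
  makes the evolution send fibres to fibres.\<close>

lemma fst_evolution_cong:
  assumes "s \<in> T" "t \<in> T" "fst z = fst z'"
  shows "fst (\<Phi> s t z) = fst (\<Phi> s t z')"
proof -
  have "\<forall>x x'. base_solution A U T x \<and> base_solution A U T x' \<and> x s = x' s \<longrightarrow>
        (\<forall>u\<in>T. x u = x' u)"
    using uniq T assms unfolding unique_solutions_def by blast
  from this[rule_format, of "\<lambda>u. fst (\<Phi> s u z)" "\<lambda>u. fst (\<Phi> s u z')"] show ?thesis
    using assms evolution_solution[OF assms(1)]
    by (simp add: evolution_self system_solution_def)
qed

lemma continuous_evolution:
  assumes "s \<in> T" "t \<in> T" shows "continuous_on UNIV (\<Phi> s t)"
  using evol assms by (simp add: evolution_def C1_diffeo_def C1_map_def)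

text \<open>Liouville's theorem along the base trajectory through \<open>x\<close>. That trajectory
  is continuous in time, so inserting it into \<open>V\<close> and its fibre derivative keeps the
  joint continuity which the locale demands.\<close>

lemma evolution_fibre_distr_lborel:
  assumes V: "fibre_field T V" and div: "\<forall>t\<in>T. \<forall>y x. divergence (\<lambda>y. V t y x) y = 0"
    and s: "s \<in> T" and t: "t \<in> T"
  shows "distr lborel borel (\<lambda>y. snd (\<Phi> s t (x, y))) = lborel"
proof -
  \<comment> \<open>The fibre value 0 is arbitrary: the base trajectory is the same for all.\<close>
  define b where "b \<tau> = fst (\<Phi> s \<tau> (x, 0))" for \<tau>
  \<comment> \<open>Starting over \<open>b t\<close> instead of \<open>x\<close> is what makes these
    maps compose: every piece runs over the same base trajectory.\<close>
  define \<psi> where "\<psi> t u y = snd (\<Phi> t u (b t, y))" for t u y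
  have fst_b: "fst (\<Phi> t u (b t, y)) = b u" if "t \<in> T" "u \<in> T" for t u y
  proof -
    have "fst (\<Phi> t u (b t, y)) = fst (\<Phi> t u (\<Phi> s t (x, 0)))"
      using that by (intro fst_evolution_cong) (auto simp: b_def)
    then show ?thesis using that s by (simp add: evolution_trans b_def)
  qed
  have pair: "\<Phi> t u (b t, y) = (b u, \<psi> t u y)" if "t \<in> T" "u \<in> T" for t u y
    using fst_b[OF that] by (simp add: \<psi>_def prod_eq_iff)
  have bcont: "continuous_on T b"
    using evolution_solution[OF s, of "(x, 0)"]
    by (simp add: system_solution_def base_solution_def b_def[abs_def])
  obtain V' :: "real \<Rightarrow> real^'k \<Rightarrow> 'm \<Rightarrow> (real^'k) \<Rightarrow>\<^sub>L (real^'k)"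
    where V': "\<And>t y x. t \<in> T \<Longrightarrow> ((\<lambda>y. V t y x) has_derivative blinfun_apply (V' t y x)) (at y)"
      and V'_cont: "continuous_on (T \<times> UNIV \<times> UNIV) (\<lambda>(t, y, x). V' t y x)"
    using V unfolding fibre_field_def by blast
  have V_cont: "continuous_on (T \<times> UNIV \<times> UNIV) (\<lambda>(t, y, x). V t y x)"
    using V unfolding fibre_field_def by blast
  have along: "continuous_on (T \<times> UNIV) (\<lambda>p. (fst p, snd p, b (fst p)))"
    by (intro continuous_intros continuous_on_compose2[OF bcont]) auto
  have "differentiable_flow T (\<lambda>t y. V t y (b t)) (\<lambda>t y. V' t y (b t)) \<psi>"
  proof
    show "continuous_on (T \<times> UNIV) (\<lambda>(t, y). V t y (b t))"
      using continuous_on_compose2[OF V_cont along] by (simp add: case_prod_unfold image_subset_iff)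
    show "continuous_on (T \<times> UNIV) (\<lambda>(t, y). V' t y (b t))"
      using continuous_on_compose2[OF V'_cont along] by (simp add: case_prod_unfold image_subset_iff)
    show "((\<lambda>y. V t y (b t)) has_derivative blinfun_apply (V' t y (b t))) (at y)"
      if "t \<in> T" for t y using V'[OF that] .
    show "\<psi> t t y = y" if "t \<in> T" for t y using that by (simp add: \<psi>_def evolution_self)
    show "((\<lambda>\<tau>. \<psi> t \<tau> y) has_vector_derivative V u (\<psi> t u y) (b u)) (at u within T)"
      if "t \<in> T" "u \<in> T" for t u y
      using evolution_solution[OF that(1), of "(b t, y)"] that fst_b
      by (simp add: system_solution_def \<psi>_def)
    show "\<psi> u v (\<psi> t u y) = \<psi> t v y" if "t \<in> T" "u \<in> T" "v \<in> T" for t u v y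
      using evolution_trans[OF that, of "(b t, y)"] that by (simp add: pair)
    show "\<psi> t u differentiable at y" if "t \<in> T" "u \<in> T" for t u y
      unfolding \<psi>_def
      using C1_map_fibre_differentiable[OF A A, of "\<Phi> t u" "b t" y] evol that
      by (simp add: evolution_def C1_diffeo_def)
  qed (rule T)
  then have "distr lborel borel (\<psi> s t) = lborel"
    by (rule flow_distr_lborel) (use div s t in \<open>simp_all add: trace_eq_divergence[OF V']\<close>)
  then show ?thesis
    using s by (simp add: \<psi>_def[abs_def] b_def evolution_self)
qed

end

section \<open>Sigma-finiteness of the reference measure\<close>

text \<open>By Lindelof countably many charts cover the space. The coefficient need not be locally
  bounded, so each chart is exhausted by sets on which both the coordinates and the coefficient are
  at most \<open>n\<close>.\<close>

lemma sigma_finite_coordinate_measure: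
  fixes A :: "('m::second_countable_topology, 'e::euclidean_space) chart set"
  assumes A: "C1_atlas A" and m: "coordinate_measure A \<gamma> m1"
  shows "sigma_finite_measure m1"
proof
  have "open S" if "S \<in> chart_dom ` A" for S
    using A that by (auto simp: C1_atlas_def is_chart_def)
  then obtain \<F> where \<F>: "\<F> \<subseteq> chart_dom ` A" "countable \<F>" "\<Union>\<F> = \<Union>(chart_dom ` A)"
    using Lindelof by metis
  then obtain C where C: "countable C" "C \<subseteq> A" "\<F> = chart_dom ` C"
    by (metis countable_subset_image)
  have cover: "(\<Union>c\<in>C. chart_dom c) = UNIV"
    using \<F> C A by (simp add: C1_atlas_def)
  \<comment> \<open>The coefficient is only measurable on the chart image; extension by 0 makes it
    Borel on the whole coordinate space.\<close>
  define g where "g c \<xi> = indicator (coords c ` chart_dom c) \<xi> *\<^sub>R \<gamma> c \<xi>" for c \<xi>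
  define Q where "Q c n = {x \<in> chart_dom c. norm (coords c x) < real n \<and> g c (coords c x) \<le> real n}"
    for c n
  have sets_m1: "sets m1 = sets borel" using m by (simp add: coordinate_measure_def)
  have Q: "Q c n \<in> sets borel" "emeasure m1 (Q c n) \<noteq> \<infinity>" if c: "c \<in> C" for c n
  proof -
    have chart: "is_chart c" using A C c by (auto simp: C1_atlas_def)
    have [measurable]: "g c \<in> borel_measurable borel"
      using m C c by (auto simp: coordinate_measure_def set_borel_measurable_def g_def[abs_def])
    have "coords c \<in> borel_measurable (restrict_space borel (chart_dom c))"
      using chart by (intro borel_measurable_continuous_on_restrict)
        (auto simp: is_chart_def homeomorphism_def)
    then have "coords c -` {\<xi>. norm \<xi> < real n \<and> g c \<xi> \<le> real n} \<inter>
        space (restrict_space borel (chart_dom c)) \<in> sets (restrict_space borel (chart_dom c))"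
      by (rule measurable_sets) measurable
    moreover have "coords c -` {\<xi>. norm \<xi> < real n \<and> g c \<xi> \<le> real n} \<inter>
        space (restrict_space borel (chart_dom c)) = Q c n"
      by (auto simp: Q_def space_restrict_space)
    moreover have "open (chart_dom c)" using chart by (simp add: is_chart_def)
    ultimately show Qb: "Q c n \<in> sets borel"
      by (simp add: sets_restrict_space_iff)
    have "Q c n \<subseteq> chart_dom c" by (auto simp: Q_def)
    then have "emeasure m1 (Q c n) = (\<integral>\<^sup>+\<xi>\<in>coords c ` Q c n. ennreal (\<gamma> c \<xi>) \<partial>lborel)"
      using m C c Qb by (auto simp: coordinate_measure_def)
    also have "\<dots> \<le> (\<integral>\<^sup>+\<xi>. ennreal (real n) * indicator (ball (0::'e) (real n)) \<xi> \<partial>lborel)"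
    proof (rule nn_integral_mono)
      fix \<xi> :: 'e
      show "ennreal (\<gamma> c \<xi>) * indicator (coords c ` Q c n) \<xi> \<le> ennreal (real n) * indicator (ball 0 (real n)) \<xi>"
      proof (cases "\<xi> \<in> coords c ` Q c n")
        case True
        then have "\<gamma> c \<xi> \<le> real n" "norm \<xi> < real n" by (auto simp: Q_def g_def)
        then show ?thesis using True by (simp add: ennreal_leI)
      qed simp
    qed
    also have "\<dots> = ennreal (real n) * emeasure lborel (ball 0 (real n) :: 'e set)"
      by (simp add: nn_integral_cmult_indicator)
    also have "\<dots> < \<infinity>"
      using emeasure_bounded_finite[OF bounded_ball, of "0::'e" "real n"]
      by (simp add: ennreal_mult_less_top)
    finally show "emeasure m1 (Q c n) \<noteq> \<infinity>" by simp
  qed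
  have "x \<in> (\<Union>c\<in>C. \<Union>n. Q c n)" for x
  proof -
    obtain c where c: "c \<in> C" "x \<in> chart_dom c" using cover by blast
    obtain n where "max (norm (coords c x)) (g c (coords c x)) < real n"
      using reals_Archimedean2 by blast
    then have "x \<in> Q c n" using c by (simp add: Q_def)
    then show ?thesis using c by blast
  qed
  then have "\<Union>(case_prod Q ` (C \<times> UNIV)) = space m1"
    using sets_eq_imp_space_eq[OF sets_m1] by (force simp: image_iff)
  moreover have "countable (case_prod Q ` (C \<times> UNIV))" using C by simp
  ultimately show "\<exists>A. countable A \<and> A \<subseteq> sets m1 \<and> \<Union>A = space m1 \<and> (\<forall>a\<in>A. emeasure m1 a \<noteq> \<infinity>)"
    using Q sets_m1 by (intro exI[of _ "case_prod Q ` (C \<times> UNIV)"]) auto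
qed

section \<open>Densities under fibre-preserving maps\<close>

text \<open>The Bochner integral is 0 where the density has infinite fibre mass. Total mass 1
  confines this to a null set, so both integrals give the same marginal density.\<close>

lemma (in prob_space) distributed_marginal_LINT:
  fixes f :: "'b \<Rightarrow> 'c \<Rightarrow> real"
  assumes S: "sigma_finite_measure S" and R: "sigma_finite_measure R"
    and D: "distributed M (S \<Otimes>\<^sub>M R) (\<lambda>\<omega>. (X \<omega>, Y \<omega>)) (\<lambda>(x, y). ennreal (f x y))"
    and nonneg: "\<And>x y. 0 \<le> f x y"
  shows "AE x in S. (\<integral>\<^sup>+y. ennreal (f x y) \<partial>R) = ennreal (LINT y|R. f x y)"
    and "distributed M S X (\<lambda>x. ennreal (LINT y|R. f x y))"
proof -
  interpret S: sigma_finite_measure S by fact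
  interpret R: sigma_finite_measure R by fact
  have [measurable]: "case_prod f \<in> borel_measurable (S \<Otimes>\<^sub>M R)"
    using distributed_real_measurable[of "S \<Otimes>\<^sub>M R" "case_prod f"] D nonneg
    by (auto simp: case_prod_unfold)
  have DX: "distributed M S X (\<lambda>x. \<integral>\<^sup>+y. ennreal (f x y) \<partial>R)"
    using distr_marginal1[OF S R D] by simp
  have "(\<integral>\<^sup>+x. (\<integral>\<^sup>+y. ennreal (f x y) \<partial>R) \<partial>S) = 1"
    using distributed_nn_integral[OF DX, of "\<lambda>_. 1"] emeasure_space_1 by simp
  then have "AE x in S. (\<integral>\<^sup>+y. ennreal (f x y) \<partial>R) \<noteq> \<infinity>"
    by (intro nn_integral_PInf_AE) auto
  then show AE: "AE x in S. (\<integral>\<^sup>+y. ennreal (f x y) \<partial>R) = ennreal (LINT y|R. f x y)"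
  proof (rule AE_mp, intro AE_I2 impI)
    fix x assume x: "x \<in> space S" and "(\<integral>\<^sup>+y. ennreal (f x y) \<partial>R) \<noteq> \<infinity>"
    then have "integrable R (f x)"
      using measurable_Pair2[of "case_prod f" S R borel x] nonneg
      by (intro integrableI_nonneg) (auto simp: less_top)
    then show "(\<integral>\<^sup>+y. ennreal (f x y) \<partial>R) = ennreal (LINT y|R. f x y)"
      using nonneg by (intro nn_integral_eq_integral) auto
  qed
  show "distributed M S X (\<lambda>x. ennreal (LINT y|R. f x y))"
  proof -
    have "distributed M S X (\<lambda>x. \<integral>\<^sup>+y. ennreal (f x y) \<partial>R) \<longleftrightarrow>
        distributed M S X (\<lambda>x. ennreal (LINT y|R. f x y))"
      using AE by (intro distributed_cong_density) auto
    then show ?thesis using DX by simp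
  qed
qed

text \<open>The first factor is expressed by the law of \<open>X\<close> instead of its density, so
  that \<open>S\<close> enters the conclusion only through its sigma-algebra and may later be
  exchanged for another reference measure.\<close>

lemma (in prob_space) distr_pair_eq_product:
  fixes r :: "'b \<Rightarrow> real" and g :: "'c \<Rightarrow> real"
  assumes S: "sigma_finite_measure S" and R: "sigma_finite_measure R"
    and D: "distributed M (S \<Otimes>\<^sub>M R) (\<lambda>\<omega>. (X \<omega>, Y \<omega>)) f"
    and X: "distributed M S X (\<lambda>x. ennreal (r x))" and Y: "distributed M R Y (\<lambda>y. ennreal (g y))"
    and f: "AE z in S \<Otimes>\<^sub>M R. f z = ennreal (r (fst z)) * ennreal (g (snd z))"
  shows "distr M (S \<Otimes>\<^sub>M R) (\<lambda>\<omega>. (X \<omega>, Y \<omega>)) = distr M S X \<Otimes>\<^sub>M density R (\<lambda>y. ennreal (g y))"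
proof -
  note [measurable] = distributed_borel_measurable[OF X] distributed_borel_measurable[OF Y]
    distributed_borel_measurable[OF D]
  have "prob_space (density R (\<lambda>y. ennreal (g y)))"
    using prob_space_distr[OF distributed_measurable[OF Y]] distributed_distr_eq_density[OF Y] by simp
  then have sf: "sigma_finite_measure (density R (\<lambda>y. ennreal (g y)))"
    by (rule prob_space_imp_sigma_finite)
  have "distr M (S \<Otimes>\<^sub>M R) (\<lambda>\<omega>. (X \<omega>, Y \<omega>)) = density (S \<Otimes>\<^sub>M R) f"
    using distributed_distr_eq_density[OF D] .
  also have "\<dots> = density (S \<Otimes>\<^sub>M R) (\<lambda>(x, y). ennreal (r x) * ennreal (g y))"
    using f by (intro density_cong) (auto simp: case_prod_unfold)
  also have "\<dots> = density S (\<lambda>x. ennreal (r x)) \<Otimes>\<^sub>M density R (\<lambda>y. ennreal (g y))"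
    using sf R by (intro pair_measure_density[symmetric]) auto
  finally show ?thesis using distributed_distr_eq_density[OF X] by simp
qed

text \<open>The image law is tested against nonnegative \<open>f\<close>. Independence splits the
  integral, the fibre variable is substituted by a map preserving \<open>R\<close>, and the base
  variable is left as the random variable \<open>fst (F (X \<omega>, Y \<omega>))\<close>, whose
  density is the fibre integral of \<open>r\<close>.\<close>

lemma (in prob_space) density_fibre_preserving_image:
  fixes r :: "'b \<Rightarrow> 'c \<Rightarrow> real" and g :: "'c \<Rightarrow> real" and F G :: "'b \<times> 'c \<Rightarrow> 'b \<times> 'c"
  assumes S: "sigma_finite_measure S" and R: "sigma_finite_measure R"
    and X: "X \<in> M \<rightarrow>\<^sub>M S" and Y: "Y \<in> M \<rightarrow>\<^sub>M R"
    and g: "g \<in> borel_measurable R" "\<And>y. 0 \<le> g y"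
    and indep: "distr M (S \<Otimes>\<^sub>M R) (\<lambda>\<omega>. (X \<omega>, Y \<omega>)) = distr M S X \<Otimes>\<^sub>M density R (\<lambda>y. ennreal (g y))"
    and F: "F \<in> S \<Otimes>\<^sub>M R \<rightarrow>\<^sub>M S \<Otimes>\<^sub>M R" and G: "G \<in> S \<Otimes>\<^sub>M R \<rightarrow>\<^sub>M S \<Otimes>\<^sub>M R"
    and GF: "\<And>z. G (F z) = z" and FG: "\<And>z. F (G z) = z"
    and \<phi>: "\<And>x y. fst (F (x, y)) = \<phi> x" and \<phi>': "\<And>x y. fst (G (x, y)) = \<phi>' x"
    and pres: "\<And>x. distr R R (\<lambda>y. snd (G (x, y))) = R"
    and D: "distributed M (S \<Otimes>\<^sub>M R) (\<lambda>\<omega>. F (X \<omega>, Y \<omega>)) (\<lambda>(x, y). ennreal (r x y))"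
    and r: "\<And>x y. 0 \<le> r x y"
  shows "AE x in S. AE y in R. r x y = (LINT y|R. r x y) * g (snd (G (x, y)))"
proof -
  interpret S: sigma_finite_measure S by fact
  interpret R: sigma_finite_measure R by fact
  interpret SR: pair_sigma_finite S R ..
  let ?N = "S \<Otimes>\<^sub>M R"
  note [measurable] = F G X Y g(1)
  have [measurable]: "case_prod r \<in> borel_measurable ?N"
    using distributed_real_measurable[of ?N "case_prod r"] D r
    by (auto simp: case_prod_unfold)
  define m where "m x = (\<integral>\<^sup>+y. ennreal (r x y) \<partial>R)" for x
  have [measurable]: "m \<in> borel_measurable S" unfolding m_def by measurable
  have sf: "sigma_finite_measure (density R (\<lambda>y. ennreal (g y)))"
    by (subst R.sigma_finite_iff_density_finite) auto
  have D': "distributed M ?N (\<lambda>\<omega>. (fst (F (X \<omega>, Y \<omega>)), snd (F (X \<omega>, Y \<omega>)))) (\<lambda>(x, y). ennreal (r x y))"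
    using D by simp
  have eq: "(\<integral>\<^sup>+z. ennreal (case_prod r z) * f z \<partial>?N) =
      (\<integral>\<^sup>+z. m (fst z) * ennreal (g (snd (G z))) * f z \<partial>?N)"
    if [measurable]: "f \<in> borel_measurable ?N" for f
  proof -
    define H where "H x = (\<integral>\<^sup>+y. ennreal (g (snd (G (x, y)))) * f (x, y) \<partial>R)" for x
    have [measurable]: "H \<in> borel_measurable S" unfolding H_def by measurable
    \<comment> \<open>The dummy point \<open>y'\<close> lets \<open>\<phi> x\<close> be written
      through \<open>F\<close>; with \<open>y' = Y \<omega>\<close> the right side becomes a
      function of the image variable.\<close>
    have sub: "(\<integral>\<^sup>+y. ennreal (g y) * f (F (x, y)) \<partial>R) = H (fst (F (x, y')))" if x: "x \<in> space S" and y': "y' \<in> space R" for x y'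
    proof -
      have FGx: "F (x, snd (G (\<phi> x, y))) = (\<phi> x, y)" for y
      proof -
        \<comment> \<open>Since \<open>F\<close> and \<open>G\<close> are inverse and preserve
          fibres, their base maps are inverse too.\<close>
        have "\<phi>' (\<phi> x) = x"
          using GF[of "(x, y)"] \<phi> \<phi>' by (metis fst_conv prod.collapse)
        then have "G (\<phi> x, y) = (x, snd (G (\<phi> x, y)))" by (simp add: prod_eq_iff \<phi>')
        then show ?thesis using FG by metis
      qed
      have "\<phi> x \<in> space S"
        using measurable_space[OF F, of "(x, y')"] x y' \<phi>[of x y'] by (auto simp: space_pair_measure)
      then have [measurable]: "(\<lambda>y. snd (G (\<phi> x, y))) \<in> R \<rightarrow>\<^sub>M R" by measurable
      have "(\<integral>\<^sup>+y. ennreal (g y) * f (F (x, y)) \<partial>R) =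
          (\<integral>\<^sup>+y. ennreal (g y) * f (F (x, y)) \<partial>distr R R (\<lambda>y. snd (G (\<phi> x, y))))"
        by (simp add: pres)
      also have "\<dots> = (\<integral>\<^sup>+y. ennreal (g (snd (G (\<phi> x, y)))) * f (F (x, snd (G (\<phi> x, y)))) \<partial>R)"
        using x by (intro nn_integral_distr) measurable
      finally show ?thesis by (simp add: FGx H_def \<phi>)
    qed
    have "(\<integral>\<^sup>+z. ennreal (case_prod r z) * f z \<partial>?N) = (\<integral>\<^sup>+\<omega>. f (F (X \<omega>, Y \<omega>)) \<partial>M)"
      using distributed_nn_integral[OF D, of f] by (simp add: case_prod_unfold)
    also have "\<dots> = (\<integral>\<^sup>+z. f (F z) \<partial>distr M ?N (\<lambda>\<omega>. (X \<omega>, Y \<omega>)))"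
      by (subst nn_integral_distr) auto
    also have "\<dots> = (\<integral>\<^sup>+x. (\<integral>\<^sup>+y. f (F (x, y)) \<partial>density R (\<lambda>y. ennreal (g y))) \<partial>distr M S X)"
      unfolding indep
    proof (rule sigma_finite_measure.nn_integral_fst[OF sf, symmetric])
      have "sets (distr M S X \<Otimes>\<^sub>M density R (\<lambda>y. ennreal (g y))) = sets ?N"
        by (intro sets_pair_measure_cong) auto
      then show "(\<lambda>z. f (F z)) \<in> borel_measurable (distr M S X \<Otimes>\<^sub>M density R (\<lambda>y. ennreal (g y)))"
        by (subst measurable_cong_sets[OF _ refl]) auto
    qed
    also have "\<dots> = (\<integral>\<^sup>+\<omega>. H (fst (F (X \<omega>, Y \<omega>))) \<partial>M)"
    proof -
      have "(\<integral>\<^sup>+x. (\<integral>\<^sup>+y. f (F (x, y)) \<partial>density R (\<lambda>y. ennreal (g y))) \<partial>distr M S X)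
          = (\<integral>\<^sup>+x. (\<integral>\<^sup>+y. ennreal (g y) * f (F (x, y)) \<partial>R) \<partial>distr M S X)"
        by (intro nn_integral_cong) (simp add: nn_integral_density)
      also have "\<dots> = (\<integral>\<^sup>+\<omega>. (\<integral>\<^sup>+y. ennreal (g y) * f (F (X \<omega>, y)) \<partial>R) \<partial>M)"
        by (subst nn_integral_distr) auto
      also have "\<dots> = (\<integral>\<^sup>+\<omega>. H (fst (F (X \<omega>, Y \<omega>))) \<partial>M)"
        using measurable_space[OF X] measurable_space[OF Y] by (intro nn_integral_cong sub)
      finally show ?thesis .
    qed
    \<comment> \<open>Here the base is transported: the law of the image base point is read off as
      the first marginal.\<close>
    also have "\<dots> = (\<integral>\<^sup>+x. m x * H x \<partial>S)"
      using distributed_nn_integral[OF distr_marginal1[OF S R D'], of H] by (simp add: m_def)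
    also have "\<dots> = (\<integral>\<^sup>+x. (\<integral>\<^sup>+y. m x * ennreal (g (snd (G (x, y)))) * f (x, y) \<partial>R) \<partial>S)"
      unfolding H_def by (intro nn_integral_cong) (simp add: nn_integral_cmult mult.assoc)
    also have "\<dots> = (\<integral>\<^sup>+z. m (fst z) * ennreal (g (snd (G z))) * f z \<partial>?N)"
      by (subst R.nn_integral_fst[symmetric]) auto
    finally show ?thesis .
  qed
  have "AE z in ?N. ennreal (case_prod r z) = m (fst z) * ennreal (g (snd (G z)))"
  proof (rule SR.density_unique)
    show "density ?N (\<lambda>z. ennreal (case_prod r z)) = density ?N (\<lambda>z. m (fst z) * ennreal (g (snd (G z))))"
      by (rule measure_eqI) (auto simp: emeasure_density eq)
  qed auto
  then have "AE x in S. AE y in R. ennreal (r x y) = m x * ennreal (g (snd (G (x, y))))"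
    by (auto dest: SR.AE_pair)
  moreover have "AE x in S. m x = ennreal (LINT y|R. r x y)"
    unfolding m_def by (rule distributed_marginal_LINT(1)[OF S R D' r])
  ultimately show ?thesis
  proof eventually_elim
    case (elim x)
    note m = elim(2)
    from elim(1) show ?case
    proof eventually_elim
      case (elim y)
      then have "ennreal (r x y) = ennreal ((LINT y|R. r x y) * g (snd (G (x, y))))"
        using m r g(2) by (simp add: ennreal_mult integral_nonneg)
      then show ?case using r g(2) by (subst (asm) ennreal_inj) (auto intro!: integral_nonneg)
    qed
  qed
qed

section \<open>Evaluation of the quotient\<close>

text \<open>The inner integral of N2 is \<open>rho1 \<rho> t x powr q * K\<close> for almost every
  \<open>x\<close>. Integrability of the power of \<open>g\<close> can be read off at a point where
  the marginal is nonzero; without such points N1 would vanish.\<close>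

lemma I_pq_of_fibre_density:
  fixes g :: "real^'k \<Rightarrow> real" and h :: "'m \<Rightarrow> real^'k \<Rightarrow> real^'k"
  assumes \<rho>: "(\<lambda>(x, y). \<rho> t x y) \<in> borel_measurable (m1 \<Otimes>\<^sub>M lborel)" "\<And>x y. 0 \<le> \<rho> t x y"
    and g: "g \<in> borel_measurable borel" "\<And>y. 0 \<le> g y"
    and h: "\<And>x. h x \<in> borel \<rightarrow>\<^sub>M borel" "\<And>x. distr lborel borel (h x) = lborel"
    and eq: "AE x in m1. AE y in lborel. \<rho> t x y = rho1 \<rho> t x * g (h x y)"
    and defd: "I_defined m1 p q t \<rho>"
  shows "integrable lborel (\<lambda>y. \<bar>g y\<bar> powr q)"
    and "I_pq m1 p q t \<rho> = (LINT y|lborel. \<bar>g y\<bar> powr q)"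
proof -
  define K where "K = (LINT y|lborel. \<bar>g y\<bar> powr q)"
  have pq: "p > 0" "q > 0" and nz: "N1 m1 (p * q) t (rho1 \<rho>) \<noteq> 0"
    and int: "AE x in m1. integrable lborel (\<lambda>y. \<bar>\<rho> t x y\<bar> powr q)"
    using defd by (auto simp: I_defined_def)
  have [measurable]: "rho1 \<rho> t \<in> borel_measurable m1"
    using \<rho>(1) unfolding rho1_def by measurable
  note [measurable] = g(1) h(1) \<rho>(1)
  have rho1: "0 \<le> rho1 \<rho> t x" for x unfolding rho1_def using \<rho>(2) by (simp add: integral_nonneg)
  \<comment> \<open>The integrability equivalence is recorded separately, because a Bochner integral
    alone does not reveal whether it is the default 0.\<close>
  have Kh: "(LINT y|lborel. \<bar>g (h x y)\<bar> powr q) = K"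
    and inth: "integrable lborel (\<lambda>y. \<bar>g (h x y)\<bar> powr q) \<longleftrightarrow> integrable lborel (\<lambda>y. \<bar>g y\<bar> powr q)" for x
    using integral_distr[of "h x" lborel borel "\<lambda>y. \<bar>g y\<bar> powr q"]
      integrable_distr_eq[of "h x" lborel borel "\<lambda>y. \<bar>g y\<bar> powr q"]
    by (simp_all add: K_def h)
  have fibre: "AE x in m1. (LINT y|lborel. \<bar>\<rho> t x y\<bar> powr q) = rho1 \<rho> t x powr q * K \<and>
      (rho1 \<rho> t x \<noteq> 0 \<longrightarrow> integrable lborel (\<lambda>y. \<bar>g y\<bar> powr q))"
    using eq int AE_space
  proof eventually_elim
    case (elim x)
    have [measurable]: "\<rho> t x \<in> borel_measurable borel"
      using measurable_Pair2[OF \<rho>(1) elim(3)] by simp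
    have ae: "AE y in lborel. \<bar>\<rho> t x y\<bar> powr q = rho1 \<rho> t x powr q * \<bar>g (h x y)\<bar> powr q"
      using elim(1) by eventually_elim (simp add: abs_mult powr_mult rho1)
    have "(LINT y|lborel. \<bar>\<rho> t x y\<bar> powr q) = (LINT y|lborel. rho1 \<rho> t x powr q * \<bar>g (h x y)\<bar> powr q)"
      using ae by (intro integral_cong_AE) auto
    moreover have "integrable lborel (\<lambda>y. rho1 \<rho> t x powr q * \<bar>g (h x y)\<bar> powr q)"
      by (rule integrable_cong_AE_imp[OF elim(2)]) (use ae in auto)
    ultimately show ?case by (auto simp: Kh inth)
  qed
  show "integrable lborel (\<lambda>y. \<bar>g y\<bar> powr q)"
  proof (rule ccontr)
    assume "\<not> ?thesis"
    then have "AE x in m1. rho1 \<rho> t x = 0" by (intro eventually_mono[OF fibre]) auto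
    then have "N1 m1 (p * q) t (rho1 \<rho>) = 0"
      unfolding N1_def by (intro integral_eq_zero_AE) (auto elim: eventually_mono)
    then show False using nz by simp
  qed
  have K: "0 \<le> K" by (simp add: K_def integral_nonneg)
  have "N2 m1 p q t \<rho> = (LINT x|m1. K powr p * rho1 \<rho> t x powr (p * q))"
    unfolding N2_def
  proof (rule integral_cong_AE)
    show "(\<lambda>x. (LINT y|lborel. \<bar>\<rho> t x y\<bar> powr q) powr p) \<in> borel_measurable m1"
      using defd by (auto simp: I_defined_def)
    show "AE x in m1. (LINT y|lborel. \<bar>\<rho> t x y\<bar> powr q) powr p = K powr p * rho1 \<rho> t x powr (p * q)"
      using fibre by eventually_elim (simp add: powr_mult powr_powr K mult.commute)
  qed auto
  also have "\<dots> = K powr p * N1 m1 (p * q) t (rho1 \<rho>)" by (simp add: N1_def)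
  finally have "I_pq m1 p q t \<rho> = K"
    using nz pq K by (simp add: I_pq_def powr_powr)
  then show "I_pq m1 p q t \<rho> = (LINT y|lborel. \<bar>g y\<bar> powr q)" by (simp add: K_def)
qed

text \<open>Independence is stated for the Borel law with a density \<open>g\<close> not tied to
  \<open>m1\<close> or \<open>\<rho>\<close>, so that the same \<open>g\<close> serves every
  admissible reference measure.\<close>

lemma I_pq_eq_LINT_rho2:
  fixes A :: "('m::second_countable_topology, 'e::euclidean_space) chart set"
    and g :: "real^'k \<Rightarrow> real"
  assumes A: "C1_atlas A" and m1: "coordinate_measure A \<gamma> m1"
    and T: "is_interval T" "0 \<in> T" "t \<in> T"
    and V: "fibre_field T V" and div: "\<forall>t\<in>T. \<forall>y x. divergence (\<lambda>y. V t y x) y = 0"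
    and uniq: "unique_solutions A U V T" and evol: "evolution A U V T \<Phi>"
    and P: "prob_space P" and \<rho>: "solution_density P X Y T \<Phi> m1 \<rho>"
    and XY: "X \<in> P \<rightarrow>\<^sub>M borel" "Y \<in> P \<rightarrow>\<^sub>M borel"
    and g: "g \<in> borel_measurable borel" "\<And>y. 0 \<le> g y"
    and indep: "distr P borel (\<lambda>\<omega>. (X \<omega>, Y \<omega>)) =
      distr P borel X \<Otimes>\<^sub>M density lborel (\<lambda>y. ennreal (g y))"
    and defd: "I_defined m1 p q t \<rho>"
  shows "integrable lborel (\<lambda>y. \<bar>g y\<bar> powr q) \<and>
    I_pq m1 p q t \<rho> = (LINT y|lborel. \<bar>g y\<bar> powr q)"
proof -
  interpret prob_space P by fact
  note ctx = A T(1) uniq evol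
  have sets_m1 [measurable_cong]: "sets m1 = sets borel"
    using m1 by (simp add: coordinate_measure_def)
  have sf: "sigma_finite_measure m1" using A m1 by (rule sigma_finite_coordinate_measure)
  \<comment> \<open>Second countability makes the product sigma-algebra the Borel one; hence
    continuity of \<open>\<Phi>\<close> gives measurability, and laws over either measure space can
    be exchanged.\<close>
  have sets_N: "sets (m1 \<Otimes>\<^sub>M lborel) = sets (borel :: ('m \<times> (real^'k)) measure)"
    by (rule trans[OF sets_pair_measure_cong[OF sets_m1 sets_lborel] arg_cong[OF borel_prod, of sets]])
  have meas: "\<Phi> s u \<in> m1 \<Otimes>\<^sub>M lborel \<rightarrow>\<^sub>M m1 \<Otimes>\<^sub>M lborel" if "s \<in> T" "u \<in> T" for s u
    using borel_measurable_continuous_onI[OF continuous_evolution[OF ctx that]]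
    by (subst measurable_cong_sets[OF sets_N sets_N])
  have fibre: "(\<lambda>y. snd (\<Phi> t 0 (x, y))) \<in> borel \<rightarrow>\<^sub>M borel" for x
    by (intro borel_measurable_continuous_onI continuous_on_snd
        continuous_on_compose2[OF continuous_evolution[OF ctx T(3,2)]] continuous_on_Pair
        continuous_on_const continuous_on_id) auto
  have pres: "distr lborel borel (\<lambda>y. snd (\<Phi> t 0 (x, y))) = lborel" for x
    using ctx V div T(3,2) by (rule evolution_fibre_distr_lborel)
  have D: "distributed P (m1 \<Otimes>\<^sub>M lborel) (\<lambda>\<omega>. \<Phi> 0 t (X \<omega>, Y \<omega>)) (\<lambda>(x, y). ennreal (\<rho> t x y))"
    and nonneg: "\<And>x y. 0 \<le> \<rho> t x y"
    using \<rho> T(3) by (auto simp: solution_density_def)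
  have "AE x in m1. AE y in lborel. \<rho> t x y = (LINT y|lborel. \<rho> t x y) * g (snd (\<Phi> t 0 (x, y)))"
  proof (rule density_fibre_preserving_image[OF sf lborel.sigma_finite_measure_axioms, of X Y g "\<Phi> 0 t"])
    show "X \<in> P \<rightarrow>\<^sub>M m1" "Y \<in> P \<rightarrow>\<^sub>M lborel" "g \<in> borel_measurable lborel"
      using XY g by auto
    show "\<Phi> t 0 (\<Phi> 0 t z) = z" "\<Phi> 0 t (\<Phi> t 0 z) = z" for z
      using T by (simp_all add: evolution_trans[OF ctx] evolution_self[OF ctx])
    show "fst (\<Phi> 0 t (x, y)) = fst (\<Phi> 0 t (x, 0))" "fst (\<Phi> t 0 (x, y)) = fst (\<Phi> t 0 (x, 0))" for x y
      using T by (auto intro: fst_evolution_cong[OF ctx])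
    show "distr lborel lborel (\<lambda>y. snd (\<Phi> t 0 (x, y))) = lborel" for x
      using pres[of x] by (simp cong: distr_cong)
    show "distr P (m1 \<Otimes>\<^sub>M lborel) (\<lambda>\<omega>. (X \<omega>, Y \<omega>)) =
        distr P m1 X \<Otimes>\<^sub>M density lborel (\<lambda>y. ennreal (g y))"
      using indep distr_cong[OF refl sets_N refl] distr_cong[OF refl sets_m1 refl] by metis
  qed (use meas T D nonneg g in auto)
  then have "AE x in m1. AE y in lborel. \<rho> t x y = rho1 \<rho> t x * g (snd (\<Phi> t 0 (x, y)))"
    by (simp add: rho1_def)
  moreover have "(\<lambda>(x, y). \<rho> t x y) \<in> borel_measurable (m1 \<Otimes>\<^sub>M lborel)"
    using distributed_real_measurable[of "m1 \<Otimes>\<^sub>M lborel" "\<lambda>(x, y). \<rho> t x y"] D nonneg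
    by (auto simp: case_prod_unfold)
  ultimately show ?thesis
    using I_pq_of_fibre_density[where h = "\<lambda>x y. snd (\<Phi> t 0 (x, y))", OF _ nonneg g fibre pres _ defd]
    by blast
qed

section \<open>The initial law and the conclusion\<close>

text \<open>As \<open>\<Phi> 0 0\<close> is the identity, \<open>\<rho> 0\<close> is a density of
  (X, Y) itself; its two marginals and the factorisation give the product law, now free of
  \<open>m1\<close> apart from the fixed function \<open>rho2 m1 \<rho>\<close>.\<close>

lemma distr_initial_independent:
  fixes A :: "('m::second_countable_topology, 'e::euclidean_space) chart set"
    and \<rho> :: "real \<Rightarrow> 'm \<Rightarrow> real^'k \<Rightarrow> real"
  assumes A: "C1_atlas A" and m1: "coordinate_measure A \<gamma> m1" and T: "0 \<in> T"
    and evol: "evolution A U V T \<Phi>"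
    and P: "prob_space P" and \<rho>: "solution_density P X Y T \<Phi> m1 \<rho>"
    and prod: "AE z in m1 \<Otimes>\<^sub>M lborel. \<rho> 0 (fst z) (snd z) = rho1 \<rho> 0 (fst z) * rho2 m1 \<rho> (snd z)"
  shows "X \<in> P \<rightarrow>\<^sub>M borel" "Y \<in> P \<rightarrow>\<^sub>M borel"
    and "rho2 m1 \<rho> \<in> borel_measurable borel" "\<And>y. 0 \<le> rho2 m1 \<rho> y"
    and "distr P borel (\<lambda>\<omega>. (X \<omega>, Y \<omega>)) =
      distr P borel X \<Otimes>\<^sub>M density lborel (\<lambda>y. ennreal (rho2 m1 \<rho> y))"
proof -
  interpret prob_space P by fact
  have sets_m1 [measurable_cong]: "sets m1 = sets borel"
    using m1 by (simp add: coordinate_measure_def)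
  have sf: "sigma_finite_measure m1" using A m1 by (rule sigma_finite_coordinate_measure)
  have sets_N: "sets (m1 \<Otimes>\<^sub>M lborel) = sets (borel :: ('m \<times> (real^'k)) measure)"
    by (rule trans[OF sets_pair_measure_cong[OF sets_m1 sets_lborel] arg_cong[OF borel_prod, of sets]])
  have \<Phi>0: "\<Phi> 0 0 z = z" for z using evol T unfolding evolution_def by blast
  have D: "distributed P (m1 \<Otimes>\<^sub>M lborel) (\<lambda>\<omega>. (X \<omega>, Y \<omega>)) (\<lambda>(x, y). ennreal (\<rho> 0 x y))"
    and nonneg: "\<And>x y. 0 \<le> \<rho> 0 x y"
    using \<rho> T by (auto simp: solution_density_def \<Phi>0)
  have DX: "distributed P m1 X (\<lambda>x. ennreal (rho1 \<rho> 0 x))"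
    unfolding rho1_def by (rule distributed_marginal_LINT(2)[OF sf lborel.sigma_finite_measure_axioms D nonneg])
  have "distributed P (lborel \<Otimes>\<^sub>M m1) (\<lambda>\<omega>. (Y \<omega>, X \<omega>)) (\<lambda>(y, x). ennreal (\<rho> 0 x y))"
    using distributed_swap[OF sf lborel.sigma_finite_measure_axioms D] by simp
  then have DY: "distributed P lborel Y (\<lambda>y. ennreal (rho2 m1 \<rho> y))"
    unfolding rho2_def
    by (rule distributed_marginal_LINT(2)[OF lborel.sigma_finite_measure_axioms sf _ nonneg])
  show rho2: "0 \<le> rho2 m1 \<rho> y" for y
    using nonneg by (simp add: rho2_def integral_nonneg)
  have rho1: "0 \<le> rho1 \<rho> 0 x" for x
    using nonneg by (simp add: rho1_def integral_nonneg)
  show "X \<in> P \<rightarrow>\<^sub>M borel" "Y \<in> P \<rightarrow>\<^sub>M borel"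
    using distributed_measurable[OF DX] distributed_measurable[OF DY]
    by (simp_all add: measurable_cong_sets[OF refl sets_m1])
  show "rho2 m1 \<rho> \<in> borel_measurable borel"
    using distributed_real_measurable[OF _ DY] rho2 by simp
  have "distr P (m1 \<Otimes>\<^sub>M lborel) (\<lambda>\<omega>. (X \<omega>, Y \<omega>)) =
      distr P m1 X \<Otimes>\<^sub>M density lborel (\<lambda>y. ennreal (rho2 m1 \<rho> y))"
    by (rule distr_pair_eq_product[OF sf lborel.sigma_finite_measure_axioms D DX DY])
       (use prod rho1 rho2 in \<open>auto simp: case_prod_unfold ennreal_mult elim: eventually_mono\<close>)
  then show "distr P borel (\<lambda>\<omega>. (X \<omega>, Y \<omega>)) =
      distr P borel X \<Otimes>\<^sub>M density lborel (\<lambda>y. ennreal (rho2 m1 \<rho> y))"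
    using distr_cong[OF refl sets_N refl] distr_cong[OF refl sets_m1 refl] by metis
qed

theorem proposition2:
  fixes A :: "('m::{second_countable_topology, t2_space}, real ^ 'n) chart set"
    and \<gamma> :: "('m, real ^ 'n) chart \<Rightarrow> (real ^ 'n) \<Rightarrow> real"
    and m1 :: "'m measure"
    and T :: "real set"
    and U :: "('m, real ^ 'n) chart \<Rightarrow> real \<Rightarrow> (real ^ 'n) \<Rightarrow> real ^ 'n"
    and V :: "real \<Rightarrow> (real ^ 'k) \<Rightarrow> 'm \<Rightarrow> real ^ 'k"
    and \<Phi> :: "real \<Rightarrow> real \<Rightarrow> 'm \<times> (real ^ 'k) \<Rightarrow> 'm \<times> (real ^ 'k)"
    and P :: "'w measure" and X :: "'w \<Rightarrow> 'm" and Y :: "'w \<Rightarrow> real ^ 'k"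
    and \<rho> :: "real \<Rightarrow> 'm \<Rightarrow> (real ^ 'k) \<Rightarrow> real"
  assumes "oriented_atlas A"
    and "coordinate_measure A \<gamma> m1"
    and "is_interval T" and "0 \<in> T"
    and "vector_field A T U"
    and "fibre_field T V"
    and "\<forall>t\<in>T. \<forall>y x. divergence (\<lambda>y. V t y x) y = 0"
    and "unique_solutions A U V T"
    and "evolution A U V T \<Phi>"
    and "prob_space P"
    and "solution_density P X Y T \<Phi> m1 \<rho>"
    and "AE z in m1 \<Otimes>\<^sub>M lborel. \<rho> 0 (fst z) (snd z) = rho1 \<rho> 0 (fst z) * rho2 m1 \<rho> (snd z)"
  shows "(\<forall>t\<in>T. \<forall>p q. I_defined m1 p q t \<rho> \<longrightarrow>
           integrable lborel (\<lambda>y. \<bar>rho2 m1 \<rho> y\<bar> powr q) \<and>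
           I_pq m1 p q t \<rho> = (LINT y|lborel. \<bar>rho2 m1 \<rho> y\<bar> powr q)) \<and>
         (\<forall>\<gamma>' m1' \<rho>'. coordinate_measure A \<gamma>' m1' \<and> solution_density P X Y T \<Phi> m1' \<rho>' \<longrightarrow>
           (\<forall>t\<in>T. \<forall>t'\<in>T. \<forall>p p' q. I_defined m1 p q t \<rho> \<and> I_defined m1' p' q t' \<rho>' \<longrightarrow>
              I_pq m1' p' q t' \<rho>' = I_pq m1 p q t \<rho>))"
proof -
  have A: "C1_atlas A" using assms(1) by (simp add: oriented_atlas_def)
  note init = distr_initial_independent[OF A assms(2,4,9,10,11,12)]
  \<comment> \<open>Measure and density vary while the right side keeps
    \<open>rho2 m1 \<rho>\<close>; this one statement yields both the formula and the comparison
    between different coefficients.\<close>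
  have I: "integrable lborel (\<lambda>y. \<bar>rho2 m1 \<rho> y\<bar> powr q) \<and>
      I_pq m1' p q t \<rho>' = (LINT y|lborel. \<bar>rho2 m1 \<rho> y\<bar> powr q)"
    if "coordinate_measure A \<gamma>' m1'" "solution_density P X Y T \<Phi> m1' \<rho>'" "t \<in> T"
      "I_defined m1' p q t \<rho>'" for \<gamma>' m1' \<rho>' t p q
    by (rule I_pq_eq_LINT_rho2[OF A that(1) assms(3,4) that(3) assms(6-10) that(2) init that(4)])
  show ?thesis
    using I[OF assms(2,11)] I by metis
qed

end
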